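(* Let $k\ge 3$ and consider the simple random walk $(A_k,\nu)$ on the dihedral Artin group $A_k$, with $\nu(a)=\nu(a^{-1})=\nu(b)=\nu(b^{-1})=1/4$. With $F_i$, $x_k$, and the drifts $\gamma_{\Sigma},\gamma_{\Delta},\gamma$ as defined in the context, one has $$\gamma_{\Sigma}=\frac{1-x_k}{2},\qquad \gamma_{\Delta}=-\frac{1-x_k}{4},$$ and the drift $\gamma$ of the length with respect to the natural generators $\{a,b,a^{-1},b^{-1}\}$ is $$\gamma=\begin{cases}(1-x_k)\Bigl[\sum_{i=1}^{j-1} i\,F_i(x_k)+\frac{j}{2}F_j(x_k)\Bigr] & \text{if } k=2j,\\[4pt] (1-x_k)\Bigl[\sum_{i=1}^{j} i\,F_i(x_k)\Bigr] & \text{if } k=2j+1.\end{cases}$$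
   Context: For $i\ge 1$ let $\mathrm{prod}(a,b;i)=abab\cdots$ be the alternating word of length $i$ starting with $a$, and $\mathrm{prod}(b,a;i)=baba\cdots$ the one starting with $b$. The dihedral Artin group is $A_k=\langle a,b\mid \mathrm{prod}(a,b;k)=\mathrm{prod}(b,a;k)\rangle$ (so $A_3=B_3$). Put $S=\{a,b,a^{-1},b^{-1}\}$, let $|g|_S$ be the word length of $g\in A_k$ with respect to $S$, and let $\Delta=\mathrm{prod}(a,b;k)=\mathrm{prod}(b,a;k)$. Let $T=\{\mathrm{prod}(a,b;i),\mathrm{prod}(b,a;i)\mid 1\le i\le k-1\}$; for $t\in T$ let $\mathrm{First}(t)$ and $\mathrm{Last}(t)\in\{a,b\}$ be the first and last letters of the corresponding alternating word. Every $g\in A_k$ can be written in a unique way as $g=t_1\cdots t_l\Delta^{m}$ with $l\ge0$, $t_i\in T$, $\mathrm{Last}(t_i)=\mathrm{First}(t_{i+1})$ for $1\le i<l$, and $m\in\mathbb{Z}$ (Garside normal form); write $\widehat g=t_1\cdots t_l$ and $|\widehat g|_T=l$. A realization of the random walk $(A_k,\nu)$ is $X_n=x^{(1)}\cdots x^{(n)}$, $X_0=1$, with $(x^{(i)})$ i.i.d. of law $\nu$; write the Garside normal form of $X_n$ as $\widehat X_n\Delta^{m_n}$. The drifts are the almost sure (constant) limits $\gamma_{\Sigma}=\lim_n|\widehat X_n|_T/n$, $\gamma_{\Delta}=\lim_n m_n/n$, $\gamma=\lim_n|X_n|_S/n$. The polynomials $F_n$ are defined by $F_0(x)=1$, $F_1(x)=x$,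 and $F_n(x)=2(2-x)F_{n-1}(x)-F_{n-2}(x)$ for $n\ge2$. For $k\ge 3$, $x_k$ denotes the unique $x\in(0,1)$ such that $F_k(x)=1$. *)

theory Defs
  imports
    "HOL-Algebra.Group"
    "HOL-Computational_Algebra.Polynomial"
    "HOL-Probability.Probability"
begin

section \<open>Groups given by generators and relations\<close>

text \<open>
  A letter \<open>(x, True)\<close> stands for the generator \<open>x\<close> and \<open>(x, False)\<close> for its formal inverse.
  A relation \<open>u = v\<close> is the pair \<open>(u, v)\<close>.
\<close>

type_synonym 'x gword = "('x \<times> bool) list"

inductive pres_eq :: "('x gword \<times> 'x gword) set \<Rightarrow> 'x gword \<Rightarrow> 'x gword \<Rightarrow> bool"
  for R :: "('x gword \<times> 'x gword) set" where
  refl: "pres_eq R u u"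
| sym: "pres_eq R u v \<Longrightarrow> pres_eq R v u"
| trans: "pres_eq R u v \<Longrightarrow> pres_eq R v w \<Longrightarrow> pres_eq R u w"
| in_context: "pres_eq R u v \<Longrightarrow> pres_eq R (p @ u @ q) (p @ v @ q)"
| cancel: "pres_eq R [(x, e), (x, \<not> e)] []"
| rel: "(u, v) \<in> R \<Longrightarrow> pres_eq R u v"

definition word_class :: "('x gword \<times> 'x gword) set \<Rightarrow> 'x gword \<Rightarrow> 'x gword set" where
  "word_class R u = {v. pres_eq R u v}"

definition presented_group :: "('x gword \<times> 'x gword) set \<Rightarrow> 'x gword set monoid" where
  "presented_group R =
     \<lparr>carrier = range (word_class R),
      monoid.mult = (\<lambda>C D. \<Union>u\<in>C. \<Union>v\<in>D. word_class R (u @ v)),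
      one = word_class R []\<rparr>"

lemma word_class_eq_iff: "word_class R u = word_class R v \<longleftrightarrow> pres_eq R u v"
proof
  assume "word_class R u = word_class R v"
  moreover have "v \<in> word_class R v"
    by (simp add: word_class_def pres_eq.refl)
  ultimately have "v \<in> word_class R u" by simp
  then show "pres_eq R u v"
    by (simp add: word_class_def)
next
  assume "pres_eq R u v"
  then show "word_class R u = word_class R v"
    unfolding word_class_def by (intro Collect_cong iffI) (blast intro: pres_eq.sym pres_eq.trans)+
qed

lemma pres_eq_append:
  assumes "pres_eq R u u'" "pres_eq R v v'"
  shows "pres_eq R (u @ v) (u' @ v')"
proof -
  have "pres_eq R (u @ v) (u' @ v)"
    using pres_eq.in_context[OF assms(1), of "[]" v] by simp
  moreover have "pres_eq R (u' @ v) (u' @ v')"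
    using pres_eq.in_context[OF assms(2), of u' "[]"] by simp
  ultimately show ?thesis by (rule pres_eq.trans)
qed

lemma mult_word_class:
  "word_class R u \<otimes>\<^bsub>presented_group R\<^esub> word_class R v = word_class R (u @ v)"
proof -
  have "word_class R (u' @ v') = word_class R (u @ v)"
    if "u' \<in> word_class R u" "v' \<in> word_class R v" for u' v'
  proof -
    from that have "pres_eq R (u @ v) (u' @ v')"
      by (intro pres_eq_append) (simp_all add: word_class_def)
    then show ?thesis by (simp add: word_class_eq_iff [symmetric])
  qed
  then have "(\<Union>u'\<in>word_class R u. \<Union>v'\<in>word_class R v. word_class R (u' @ v')) =
      (\<Union>u'\<in>word_class R u. \<Union>v'\<in>word_class R v. word_class R (u @ v))"
    by (intro SUP_cong HOL.refl)
  moreover have "word_class R u \<noteq> {}" "word_class R v \<noteq> {}"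
    using pres_eq.refl unfolding word_class_def by blast+
  ultimately show ?thesis
    by (simp add: presented_group_def)
qed

lemma pres_eq_inverse:
  "pres_eq R (rev (map (\<lambda>(x, e). (x, \<not> e)) u) @ u) []"
proof (induction u)
  case Nil
  then show ?case by (simp add: pres_eq.refl)
next
  case (Cons l u)
  obtain x e where l: "l = (x, e)" by force
  let ?w = "rev (map (\<lambda>(x, e). (x, \<not> e)) u)"
  have "pres_eq R [(x, \<not> e), (x, e)] []"
    using pres_eq.cancel[of R x "\<not> e"] by simp
  from pres_eq.in_context[OF this, of ?w u]
  have "pres_eq R (?w @ [(x, \<not> e), (x, e)] @ u) (?w @ u)" by simp
  from pres_eq.trans[OF this Cons.IH] show ?case by (simp add: l)
qed

lemma group_presented_group: "group (presented_group R)"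
proof (rule groupI)
  have car: "carrier (presented_group R) = range (word_class R)"
    and one: "\<one>\<^bsub>presented_group R\<^esub> = word_class R []"
    by (simp_all add: presented_group_def)
  show "\<one>\<^bsub>presented_group R\<^esub> \<in> carrier (presented_group R)"
    by (simp add: car one)
  fix C assume "C \<in> carrier (presented_group R)"
  then obtain u where C: "C = word_class R u" by (auto simp: car)
  show "\<one>\<^bsub>presented_group R\<^esub> \<otimes>\<^bsub>presented_group R\<^esub> C = C"
    by (simp add: C one mult_word_class)
  show "\<exists>D\<in>carrier (presented_group R). D \<otimes>\<^bsub>presented_group R\<^esub> C = \<one>\<^bsub>presented_group R\<^esub>"
    using pres_eq_inverse[of R u] 
    by (intro bexI[of _ "word_class R (rev (map (\<lambda>(x, e). (x, \<not> e)) u))"])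
      (simp_all add: C car one mult_word_class word_class_eq_iff rangeI)
  fix D assume "D \<in> carrier (presented_group R)"
  then obtain v where D: "D = word_class R v" by (auto simp: car)
  show "C \<otimes>\<^bsub>presented_group R\<^esub> D \<in> carrier (presented_group R)"
    by (simp add: C D car mult_word_class)
  fix E assume "E \<in> carrier (presented_group R)"
  then obtain w where E: "E = word_class R w" by (auto simp: car)
  show "C \<otimes>\<^bsub>presented_group R\<^esub> D \<otimes>\<^bsub>presented_group R\<^esub> E =
        C \<otimes>\<^bsub>presented_group R\<^esub> (D \<otimes>\<^bsub>presented_group R\<^esub> E)"
    by (simp add: C D E mult_word_class)
qed

definition gprod :: "('g, 'm) monoid_scheme \<Rightarrow> 'g list \<Rightarrow> 'g" where
  "gprod G gs = foldr (monoid.mult G) gs (one G)"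

definition word_length :: "('g, 'm) monoid_scheme \<Rightarrow> 'g set \<Rightarrow> 'g \<Rightarrow> nat" where
  "word_length G S g = (LEAST n. \<exists>ss. set ss \<subseteq> S \<and> length ss = n \<and> gprod G ss = g)"


section \<open>Dihedral Artin groups\<close>

datatype gen = ga | gb

fun alt :: "'x \<Rightarrow> 'x \<Rightarrow> nat \<Rightarrow> 'x list" where
  "alt x y 0 = []"
| "alt x y (Suc n) = x # alt y x n"

definition pos :: "'x list \<Rightarrow> 'x gword" where
  "pos w = map (\<lambda>x. (x, True)) w"

definition artin_rels :: "nat \<Rightarrow> (gen gword \<times> gen gword) set" where
  "artin_rels k = {(pos (alt ga gb k), pos (alt gb ga k))}"

definition artin :: "nat \<Rightarrow> gen gword set monoid" where
  "artin k = presented_group (artin_rels k)"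

definition gen_elt :: "nat \<Rightarrow> gen \<Rightarrow> gen gword set" where
  "gen_elt k x = word_class (artin_rels k) [(x, True)]"

definition pos_elt :: "nat \<Rightarrow> gen list \<Rightarrow> gen gword set" where
  "pos_elt k w = word_class (artin_rels k) (pos w)"

definition nat_gens :: "nat \<Rightarrow> gen gword set set" where
  "nat_gens k = {gen_elt k ga, gen_elt k gb, inv\<^bsub>artin k\<^esub> gen_elt k ga, inv\<^bsub>artin k\<^esub> gen_elt k gb}"

definition Delta :: "nat \<Rightarrow> gen gword set" where
  "Delta k = pos_elt k (alt ga gb k)"

text \<open>
  The elements of \<open>T\<close> are represented by their alternating words, so that \<open>First\<close> and \<open>Last\<close>
  are \<^const>\<open>hd\<close> and \<^const>\<open>last\<close>; \<^const>\<open>pos_elt\<close> maps such a word to the group element.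
\<close>

definition T_words :: "nat \<Rightarrow> gen list set" where
  "T_words k = {alt ga gb i | i. 1 \<le> i \<and> i \<le> k - 1} \<union> {alt gb ga i | i. 1 \<le> i \<and> i \<le> k - 1}"

definition is_garside_nf :: "nat \<Rightarrow> gen gword set \<Rightarrow> gen list list \<Rightarrow> int \<Rightarrow> bool" where
  "is_garside_nf k g ts m \<longleftrightarrow>
     set ts \<subseteq> T_words k \<and>
     (\<forall>i. Suc i < length ts \<longrightarrow> last (ts ! i) = hd (ts ! Suc i)) \<and>
     g = gprod (artin k) (map (pos_elt k) ts) \<otimes>\<^bsub>artin k\<^esub> (Delta k [^]\<^bsub>artin k\<^esub> m)"

definition garside_nf :: "nat \<Rightarrow> gen gword set \<Rightarrow> gen list list \<times> int" where
  "garside_nf k g = (THE p. is_garside_nf k g (fst p) (snd p))"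

definition T_length :: "nat \<Rightarrow> gen gword set \<Rightarrow> nat" where
  "T_length k g = length (fst (garside_nf k g))"

definition Delta_exp :: "nat \<Rightarrow> gen gword set \<Rightarrow> int" where
  "Delta_exp k g = snd (garside_nf k g)"

definition S_length :: "nat \<Rightarrow> gen gword set \<Rightarrow> nat" where
  "S_length k g = word_length (artin k) (nat_gens k) g"


section \<open>Random walks and drifts\<close>

definition iid_steps :: "'w measure \<Rightarrow> 'g pmf \<Rightarrow> (nat \<Rightarrow> 'w \<Rightarrow> 'g) \<Rightarrow> bool" where
  "iid_steps M \<nu> x \<longleftrightarrow>
     prob_space M \<and>
     prob_space.indep_vars M (\<lambda>_. count_space UNIV) x {1..} \<and>
     (\<forall>i\<ge>1. distr M (count_space UNIV) (x i) = measure_pmf \<nu>)"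

definition walk :: "('g, 'm) monoid_scheme \<Rightarrow> (nat \<Rightarrow> 'w \<Rightarrow> 'g) \<Rightarrow> nat \<Rightarrow> 'w \<Rightarrow> 'g" where
  "walk G x n \<omega> = gprod G (map (\<lambda>i. x i \<omega>) [1..<Suc n])"

definition has_drift ::
  "'w measure \<Rightarrow> (nat \<Rightarrow> 'w \<Rightarrow> 'g) \<Rightarrow> ('g \<Rightarrow> real) \<Rightarrow> real \<Rightarrow> bool" where
  "has_drift M X f c \<longleftrightarrow> (AE \<omega> in M. (\<lambda>n. f (X n \<omega>) / real n) \<longlonglongrightarrow> c)"


section \<open>The polynomials \<open>F\<^sub>n\<close> and the numbers \<open>x\<^sub>k\<close>\<close>

fun F_poly :: "nat \<Rightarrow> real poly" where
  "F_poly 0 = 1"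
| "F_poly (Suc 0) = [:0, 1:]"
| "F_poly (Suc (Suc n)) = 2 * [:2, -1:] * F_poly (Suc n) - F_poly n"

definition x_root :: "nat \<Rightarrow> real" where
  "x_root k = (THE x. 0 < x \<and> x < 1 \<and> poly (F_poly k) x = 1)"

end

theory Submission
  imports Defs
begin

text \<open>
  Multiplying on the right by a generator changes only the last factor of the Garside normal form:
  a new factor of length \<open>1\<close> or \<open>k - 1\<close> is appended, or the length of the last factor
  moves by one and the factor disappears when the length reaches \<open>0\<close> or \<open>k\<close>. For the simple
  random walk these four moves are equally likely, and \<open>F\<^sub>i(x\<^sub>k)\<close> is the probability that a factor
  of length \<open>i\<close> is ever erased. For every \<open>h\<close> the sum of \<open>h\<close> over the lengths of the factors
  admits a bounded correction, built from these probabilities, whose expected increment is constant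
  as long as the normal form is not a power of \<open>\<Delta>\<close>. A strong law for bounded martingale
  differences turns this constant into the almost sure rate
  \<open>(1 - x\<^sub>k) / 2 * (\<Sum>i = 1..<k. F\<^sub>i(x\<^sub>k) * h i)\<close>. The drift of \<open>\<Delta>\<close> then follows from the
  exponent sum, and the word length differs by \<open>o(n)\<close> from the sum of \<open>min i (k - i)\<close>, because
  about half of the factors can be combined with the negative powers of \<open>\<Delta>\<close>.
\<close>

section \<open>The polynomials \<open>F\<^sub>n\<close> and their root \<open>x\<^sub>k\<close>\<close>

lemma poly_F_Suc_Suc:
  "poly (F_poly (Suc (Suc n))) x = 2 * (2 - x) * poly (F_poly (Suc n)) x - poly (F_poly n) x"
  by (simp add: algebra_simps)

lemma poly_F_rec:
  assumes "0 < i"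
  shows "poly (F_poly (i + 1)) x + poly (F_poly (i - 1)) x = 2 * (2 - x) * poly (F_poly i) x"
proof -
  obtain n where "i = Suc n" using assms by (cases i) auto
  then show ?thesis using poly_F_Suc_Suc[of n x] by simp
qed

section \<open>Second order recurrences on an interval: maximum principle and Dirichlet
  problem\<close>

lemma discrete_maximum_principle:
  fixes f :: "nat \<Rightarrow> real"
  assumes a: "a > 1" and bd: "f 0 \<le> 0" "f k \<le> 0"
    and sub: "\<And>i. 0 < i \<Longrightarrow> i < k \<Longrightarrow> 2 * a * f i \<le> f (i + 1) + f (i - 1)"
    and "i \<le> k"
  shows "f i \<le> 0"
proof (rule ccontr)
  assume neg: "\<not> f i \<le> 0"
  define m where "m = Max (f ` {..k})"
  have le: "f j \<le> m" if "j \<le> k" for j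
    unfolding m_def using that by (intro Max_ge) auto
  have "m \<in> f ` {..k}"
    unfolding m_def by (intro Max_in) auto
  then obtain j where j: "j \<le> k" "f j = m" by auto
  have pos: "m > 0" using neg le[OF \<open>i \<le> k\<close>] by simp
  have "j \<noteq> 0" "j \<noteq> k" using j bd pos by (metis not_less)+
  then have "0 < j" "j < k" using j by auto
  moreover have "f (j + 1) \<le> m" "f (j - 1) \<le> m" using le \<open>j < k\<close> by auto
  \<comment> \<open>At an interior index where the maximum \<open>m\<close> is attained both
    neighbours are at most \<open>m\<close>, which contradicts \<open>a > 1\<close> and
    \<open>m > 0\<close>.\<close>
  ultimately have "2 * a * m \<le> m + m"
    using sub[of j] j by auto
  then have "(a - 1) * m \<le> 0" by (simp add: algebra_simps)
  with a pos show False by (simp add: mult_le_0_iff)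
qed

lemma discrete_dirichlet_unique:
  fixes f :: "nat \<Rightarrow> real"
  assumes "a > 1" "f 0 = 0" "f k = 0"
    and "\<And>i. 0 < i \<Longrightarrow> i < k \<Longrightarrow> f (i + 1) + f (i - 1) = 2 * a * f i"
    and "i \<le> k"
  shows "f i = 0"
proof (rule antisym)
  show "f i \<le> 0"
    by (rule discrete_maximum_principle[of a f k]) (use assms in auto)
  have "- f i \<le> 0"
  proof (rule discrete_maximum_principle[of a "\<lambda>i. - f i" k])
    fix i :: nat assume "0 < i" "i < k"
    then show "2 * a * - f i \<le> - f (i + 1) + - f (i - 1)" using assms(4)[of i] by simp
  qed (use assms in auto)
  then show "f i \<ge> 0" by simp
qed

text \<open>Shooting from the left end; the boundary value at \<open>k\<close> is met by choosing the slope \<open>s\<close>.\<close>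

fun shoot :: "real \<Rightarrow> (nat \<Rightarrow> real) \<Rightarrow> real \<Rightarrow> nat \<Rightarrow> real" where
  "shoot a r s 0 = 0"
| "shoot a r s (Suc 0) = s"
| "shoot a r s (Suc (Suc n)) = 2 * a * shoot a r s (Suc n) - shoot a r s n - r (Suc n)"

lemma shoot_affine: "shoot a r s n = shoot a r 0 n + s * shoot a (\<lambda>_. 0) 1 n"
  by (induction a r s n rule: shoot.induct) (simp_all add: algebra_simps)

text \<open>For \<open>a \<ge> 1\<close> the homogeneous solution is convex while nonnegative, so
  its initial increment 1 never decreases. Its value at a positive endpoint is therefore nonzero,
  and the slope can be solved for.\<close>

lemma shoot_increasing:
  assumes "a \<ge> 1"
  shows "0 \<le> shoot a (\<lambda>_. 0) 1 n \<and> shoot a (\<lambda>_. 0) 1 n + 1 \<le> shoot a (\<lambda>_. 0) 1 (Suc n)"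
proof (induction n)
  case (Suc n)
  have "1 * shoot a (\<lambda>_. 0) 1 (Suc n) \<le> a * shoot a (\<lambda>_. 0) 1 (Suc n)"
    using assms Suc by (intro mult_right_mono) auto
  then have "2 * shoot a (\<lambda>_. 0) 1 (Suc n) \<le> 2 * a * shoot a (\<lambda>_. 0) 1 (Suc n)" by simp
  with Suc show ?case unfolding shoot.simps by linarith
qed simp

lemma discrete_dirichlet_exists:
  assumes "a \<ge> 1" "k > 0"
  obtains w :: "nat \<Rightarrow> real" where "w 0 = 0" "w k = 0"
    "\<And>i. 0 < i \<Longrightarrow> w (i + 1) + w (i - 1) - 2 * a * w i = - r i"
proof -
  let ?y = "shoot a (\<lambda>_. 0) 1 k"
  \<comment> \<open>By \<open>shoot_affine\<close> the value at \<open>k\<close> is affine in the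
    slope; \<open>s\<close> is its zero.\<close>
  define s where "s = - shoot a r 0 k / ?y"
  obtain k' where "k = Suc k'" using assms by (cases k) auto
  then have "?y \<noteq> 0" using shoot_increasing[OF assms(1), of k'] by auto
  then have "shoot a r s k = 0"
    by (subst shoot_affine) (simp add: s_def)
  moreover have "shoot a r s (i + 1) + shoot a r s (i - 1) - 2 * a * shoot a r s i = - r i"
    if "0 < i" for i
    using that by (cases i) auto
  ultimately show thesis using that[of "shoot a r s"] by simp
qed

text \<open>The recurrence says that the second difference of F at an index equals 2(1 - x) times
  the value there; it is summed starting from F_1 - F_0 = -(1 - x).\<close>

lemma F_diff_telescope:
  "poly (F_poly (Suc n)) x - poly (F_poly n) x
     = (1 - x) * (2 * (\<Sum>i=1..n. poly (F_poly i) x) - 1)"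
proof (induction n)
  case (Suc n)
  have "poly (F_poly (Suc (Suc n))) x - poly (F_poly (Suc n)) x
      = (poly (F_poly (Suc n)) x - poly (F_poly n) x) + 2 * (1 - x) * poly (F_poly (Suc n)) x"
    by (simp only: poly_F_Suc_Suc) (simp add: algebra_simps)
  then show ?case by (simp only: Suc) (simp add: algebra_simps)
qed simp

text \<open>Splits off the trivial solution x = 1 of F_n(x) = 1, so that a root inside the open
  interval can be sought as a zero of the cofactor.\<close>

lemma F_minus_one_factor:
  "poly (F_poly n) x - 1 = (1 - x) * (\<Sum>j<n. 2 * (\<Sum>i=1..j. poly (F_poly i) x) - 1)"
proof (induction n)
  case (Suc n)
  then show ?case using F_diff_telescope[of n x] by (simp add: algebra_simps)
qed simp

lemma poly_F_1: "poly (F_poly n) 1 = 1"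
  by (induction n rule: F_poly.induct) simp_all

text \<open>Serves to make the cofactor in \<open>F_minus_one_factor\<close> negative at 0, since
  F_k(0) \<le> 0 < 1.\<close>

lemma poly_F_0: "poly (F_poly (Suc (Suc n))) 0 \<le> poly (F_poly (Suc n)) 0 \<and> poly (F_poly (Suc n)) 0 \<le> 0"
proof (induction n)
  case (Suc n)
  then show ?case unfolding poly_F_Suc_Suc[of "Suc n" 0] by simp
qed simp

text \<open>An arbitrary root is fixed instead of \<open>x_root k\<close>, so that the same facts
  can be applied to two roots when uniqueness is proved.\<close>

locale F_root =
  fixes k :: nat and x :: real
  assumes k3: "k \<ge> 3" and x0: "0 < x" and x1: "x < 1" and root: "poly (F_poly k) x = 1"
begin

abbreviation q :: "nat \<Rightarrow> real" where "q i \<equiv> poly (F_poly i) x"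

lemma q_nonneg: "i \<le> k \<Longrightarrow> 0 \<le> q i"
proof -
  assume i: "i \<le> k"
  have "- q i \<le> 0"
  proof (rule discrete_maximum_principle[of "2 - x" "\<lambda>i. - q i" k i])
    fix i :: nat assume "0 < i"
    then show "2 * (2 - x) * - q i \<le> - q (i + 1) + - q (i - 1)"
      using poly_F_rec[of i x] by simp
  qed (use i x1 root in auto)
  then show ?thesis by simp
qed

text \<open>Since 2(2 - x) \<ge> 2, subtracting the constant 1 turns the solution \<open>q\<close>
  into a subsolution, with boundary values 0.\<close>

lemma q_le_1: "i \<le> k \<Longrightarrow> q i \<le> 1"
proof -
  assume i: "i \<le> k"
  have "q i - 1 \<le> 0"
  proof (rule discrete_maximum_principle[of "2 - x" "\<lambda>i. q i - 1" k i])
    fix i :: nat assume "0 < i"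
    then show "2 * (2 - x) * (q i - 1) \<le> (q (i + 1) - 1) + (q (i - 1) - 1)"
      using poly_F_rec[of i x] x1 by (simp add: algebra_simps)
  qed (use i x1 root in auto)
  then show ?thesis by simp
qed

text \<open>An interior value 1 would force 2(2 - x) \<le> 2. The strict bound later makes the
  correction terms sum like a geometric series.\<close>

lemma q_less_1:
  assumes "0 < i" "i < k"
  shows "q i < 1"
proof (rule ccontr)
  assume "\<not> q i < 1"
  then have "q i = 1" using q_le_1[of i] assms by simp
  moreover have "q (i + 1) \<le> 1" "q (i - 1) \<le> 1" using q_le_1 assms by auto
  ultimately have "2 * (2 - x) \<le> 1 + 1"
    using poly_F_rec[of i x] assms by auto
  then show False using x1 by simp
qed

text \<open>Reflection preserves the recurrence and the boundary values 1 at both ends, and the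
  Dirichlet problem has only one solution.\<close>

lemma q_sym: "i \<le> k \<Longrightarrow> q (k - i) = q i"
proof -
  assume i: "i \<le> k"
  have "q (k - i) - q i = 0"
  proof (rule discrete_dirichlet_unique[of "2 - x" "\<lambda>i. q (k - i) - q i" k i])
    fix i :: nat assume "0 < i" "i < k"
    then have "k - (i + 1) = (k - i) - 1" "k - (i - 1) = (k - i) + 1" by auto
    then show "(q (k - (i + 1)) - q (i + 1)) + (q (k - (i - 1)) - q (i - 1))
        = 2 * (2 - x) * (q (k - i) - q i)"
      using poly_F_rec[of i x] poly_F_rec[of "k - i" x] \<open>0 < i\<close> \<open>i < k\<close>
      by (simp add: algebra_simps)
  qed (use i x1 root in auto)
  then show ?thesis by simp
qed

text \<open>By symmetry F_{k-1}(x) = F_1(x) = x, so the last difference F_k - F_{k-1} is 1 - x;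
  comparison with \<open>F_diff_telescope\<close> gives the sum.\<close>

lemma q_sum: "(\<Sum>i=1..<k. q i) = 1"
proof -
  obtain n where n: "k = Suc n" using k3 by (cases k) auto
  have "q n = x" using q_sym[of 1] k3 n by simp
  then have "(1 - x) * 1 = (1 - x) * (2 * (\<Sum>i=1..n. q i) - 1)"
    using F_diff_telescope[of n x] root n by simp
  then have "1 = 2 * (\<Sum>i=1..n. q i) - 1" using x1 by (subst (asm) mult_left_cancel) auto
  moreover have "{1..<k} = {1..n}" using n by auto
  ultimately show ?thesis by simp
qed

lemma q_sum_symmetric:
  assumes "\<And>i. 0 < i \<Longrightarrow> i < k \<Longrightarrow> f i + f (k - i) = (c::real)"
  shows "(\<Sum>i=1..<k. q i * f i) = c / 2"
proof -
  have "(\<Sum>i=1..<k. q i * f i) = (\<Sum>i=1..<k. q (k - i) * f (k - i))"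
    by (rule sum.reindex_bij_witness[of _ "\<lambda>i. k - i" "\<lambda>i. k - i"]) auto
  also have "\<dots> = (\<Sum>i=1..<k. q i * f (k - i))"
    by (intro sum.cong) (auto simp: q_sym)
  finally have "2 * (\<Sum>i=1..<k. q i * f i) = (\<Sum>i=1..<k. q i * (f i + f (k - i)))"
    by (simp add: sum.distrib distrib_left)
  also have "\<dots> = (\<Sum>i=1..<k. q i * c)"
    using assms by (intro sum.cong) auto
  also have "\<dots> = c" using q_sum by (simp add: sum_distrib_right[symmetric])
  finally show ?thesis by simp
qed

lemma q_sum_min_odd:
  assumes "k = 2 * j + 1"
  shows "(\<Sum>i=1..<k. q i * real (min i (k - i))) = 2 * (\<Sum>i=1..j. real i * q i)"
proof -
  have "{1..<k} = {1..j} \<union> {Suc j..2 * j}" using assms by auto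
  then have "(\<Sum>i=1..<k. q i * real (min i (k - i))) =
      (\<Sum>i=1..j. q i * real (min i (k - i))) + (\<Sum>i=Suc j..2 * j. q i * real (min i (k - i)))"
    by (simp only:) (subst sum.union_disjoint; auto)
  also have "(\<Sum>i=Suc j..2 * j. q i * real (min i (k - i))) = (\<Sum>i=1..j. q i * real (min i (k - i)))"
    by (rule sum.reindex_bij_witness[of _ "\<lambda>i. k - i" "\<lambda>i. k - i"])
      (use assms q_sym in \<open>auto simp: min.commute\<close>)
  also have "(\<Sum>i=1..j. q i * real (min i (k - i))) = (\<Sum>i=1..j. real i * q i)"
    by (intro sum.cong) (use assms in auto)
  finally show ?thesis by simp
qed

lemma q_sum_min_even:
  assumes "k = 2 * j"
  shows "(\<Sum>i=1..<k. q i * real (min i (k - i))) = 2 * ((\<Sum>i=1..j-1. real i * q i) + real j / 2 * q j)"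
proof -
  have "{1..<k} = {1..j-1} \<union> ({j} \<union> {Suc j..<k})" using k3 assms by auto
  then have "(\<Sum>i=1..<k. q i * real (min i (k - i))) = (\<Sum>i=1..j-1. q i * real (min i (k - i)))
      + (q j * real j + (\<Sum>i=Suc j..<k. q i * real (min i (k - i))))"
    using assms by (simp only:) (subst sum.union_disjoint; auto)+
  also have "(\<Sum>i=Suc j..<k. q i * real (min i (k - i))) = (\<Sum>i=1..j-1. q i * real (min i (k - i)))"
    by (rule sum.reindex_bij_witness[of _ "\<lambda>i. k - i" "\<lambda>i. k - i"])
      (use assms q_sym in \<open>auto simp: min.commute\<close>)
  also have "(\<Sum>i=1..j-1. q i * real (min i (k - i))) = (\<Sum>i=1..j-1. real i * q i)"
    by (intro sum.cong) (use assms in auto)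
  finally show ?thesis by (simp add: algebra_simps)
qed

end

text \<open>Two roots \<open>x < y\<close> are excluded because \<open>i \<mapsto> F\<^sub>i(y) - F\<^sub>i(x)\<close> would be nonnegative and
  positive at \<open>1\<close>, while both families sum to \<open>1\<close>.\<close>

lemma F_root_not_less:
  assumes "F_root k x" "F_root k y"
  shows "\<not> x < y"
proof
  assume "x < y"
  interpret X: F_root k x by fact
  interpret Y: F_root k y by fact
  let ?e = "\<lambda>i. X.q i - Y.q i"
  have le: "?e i \<le> 0" if "i \<le> k" for i
  proof (rule discrete_maximum_principle[of "2 - y" ?e k i])
    fix i :: nat assume i: "0 < i" "i < k"
    have "0 \<le> 2 * (y - x) * X.q i" using \<open>x < y\<close> X.q_nonneg[of i] i by simp
    then show "2 * (2 - y) * ?e i \<le> ?e (i + 1) + ?e (i - 1)"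
      using poly_F_rec[of i x] poly_F_rec[of i y] i by (simp add: algebra_simps)
  qed (use that Y.x1 X.root Y.root in auto)
  have "(\<Sum>i=1..<k. X.q i) < (\<Sum>i=1..<k. Y.q i)"
  proof (rule sum_strict_mono_ex1)
    show "\<forall>i\<in>{1..<k}. X.q i \<le> Y.q i" using le by auto
    show "\<exists>i\<in>{1..<k}. X.q i < Y.q i" using X.k3 \<open>x < y\<close> by (intro bexI[of _ 1]) auto
  qed simp
  then show False using X.q_sum Y.q_sum by simp
qed

text \<open>The intermediate value theorem is applied to the cofactor \<open>?R\<close> of 1 - x,
  which is negative at 0 and equals k(k - 2) > 0 at 1.\<close>

lemma F_root_exists:
  assumes "k \<ge> 3"
  obtains x where "F_root k x"
proof -
  let ?R = "\<lambda>x. \<Sum>j<k. 2 * (\<Sum>i=1..j. poly (F_poly i) x) - (1::real)"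
  obtain n where n: "k = Suc (Suc n)" using assms le_Suc_ex[of 2 k] by auto
  have R0: "?R 0 < 0" using F_minus_one_factor[of k 0] poly_F_0[of n] n by simp
  have "?R 1 = (\<Sum>j<k. 2 * real j - 1)" by (simp add: poly_F_1)
  also have "\<dots> = real k * (real k - 2)" by (induction k) (simp_all add: algebra_simps)
  finally have R1: "?R 1 > 0" using assms by simp
  have "continuous_on {0..1} ?R" by (intro continuous_intros)
  then obtain x where x: "0 \<le> x" "x \<le> 1" "?R x = 0"
    using IVT'[of ?R 0 0 1] R0 R1 by auto
  have "x \<noteq> 0" using x(3) R0 by (intro notI) (simp del: sum.lessThan_Suc)
  moreover have "x \<noteq> 1" using x(3) R1 by (intro notI) (simp del: sum.lessThan_Suc)
  moreover have "poly (F_poly k) x = 1" using F_minus_one_factor[of k x] x by simp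
  ultimately have "F_root k x" using x assms by (simp add: F_root_def)
  then show thesis by (rule that)
qed

lemma F_root_x_root:
  assumes "k \<ge> 3"
  shows "F_root k (x_root k)"
proof -
  obtain x where x: "F_root k x" using F_root_exists[OF assms] by blast
  have "x_root k = x"
    unfolding x_root_def
  proof (rule the_equality)
    show "0 < x \<and> x < 1 \<and> poly (F_poly k) x = 1" using x by (simp add: F_root_def)
    fix y assume "0 < y \<and> y < 1 \<and> poly (F_poly k) y = 1"
    then have "F_root k y" using assms by (simp add: F_root_def)
    then show "y = x" using F_root_not_less x by (metis linorder_neqE)
  qed
  with x show ?thesis by simp
qed

section \<open>The action on normal forms\<close>

lemma alt_Suc_right: "alt x y (Suc n) = alt x y n @ [if even n then x else y]"
  by (induction n arbitrary: x y) auto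

lemma alt_add: "alt x y (m + n) = alt x y m @ (if even m then alt x y n else alt y x n)"
  by (induction m arbitrary: x y) auto

lemma length_alt [simp]: "length (alt x y n) = n"
  by (induction n arbitrary: x y) auto

lemma hd_alt: "0 < n \<Longrightarrow> hd (alt x y n) = x"
  by (cases n) auto

lemma last_alt: "0 < n \<Longrightarrow> last (alt x y n) = (if odd n then x else y)"
  by (cases n) (auto simp del: alt.simps simp: alt_Suc_right)

lemma pos_append [simp]: "pos (u @ v) = pos u @ pos v"
  by (simp add: pos_def)

lemma pos_Cons [simp]: "pos (c # u) = (c, True) # pos u"
  by (simp add: pos_def)

lemma pos_Nil [simp]: "pos [] = []"
  by (simp add: pos_def)

lemma length_pos [simp]: "length (pos u) = length u"
  by (simp add: pos_def)

fun other :: "gen \<Rightarrow> gen" where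
  "other ga = gb"
| "other gb = ga"

lemma other_other [simp]: "other (other c) = c"
  by (cases c) auto

lemma other_neq [simp]: "other c \<noteq> c" "c \<noteq> other c"
  by (cases c; simp)+

lemma eq_other_iff: "c = other d \<longleftrightarrow> c \<noteq> d"
  by (cases c; cases d) auto

lemma other_inject [simp]: "other c = other d \<longleftrightarrow> c = d"
  by (cases c; cases d) auto

text \<open>
  A state \<open>(L, e, m)\<close> encodes the group element \<open>\<Delta>\<^sup>m s\<close>, where \<open>s\<close> is a product of elements
  of \<open>T\<close> in normal form: \<open>L\<close> lists the lengths of its factors, rightmost factor first, and \<open>e\<close> is
  its last letter (\<open>ga\<close> by convention if \<open>L\<close> is empty). With \<open>\<Delta>\<close> in front, right
  multiplication by a generator does not depend on the parities of \<open>k\<close> and \<open>m\<close>.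
\<close>

type_synonym state = "nat list \<times> gen \<times> int"

text \<open>A product without factors has no last letter; fixing one makes each power of
  \<open>\<Delta>\<close> a single state, as equations such as \<open>act_cancel\<close>
  require.\<close>

definition canon :: "nat list \<Rightarrow> gen \<Rightarrow> int \<Rightarrow> state" where
  "canon L e m = (L, if L = [] then ga else e, m)"

text \<open>The inverse of \<open>c\<close> is \<open>\<Delta>\<close>^-1 times the alternating word
  of length \<open>k - 1\<close> that ends in \<open>other c\<close>. Moving this power of
  \<open>\<Delta>\<close> to the front conjugates the earlier factors, and the new factor then links
  to them exactly when \<open>c \<noteq> e\<close>; for \<open>c = e\<close> the last letter cancels
  instead. A factor that reaches length \<open>k\<close> is \<open>\<Delta>\<close> and moves to the
  front as well.\<close>

fun act :: "nat \<Rightarrow> state \<Rightarrow> gen \<times> bool \<Rightarrow> state" where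
  "act k ([], e, m) (c, True) = ([1], c, m)"
| "act k (i # L, e, m) (c, True) =
     (if c = e then (1 # i # L, e, m)
      else if Suc i < k then (Suc i # L, c, m) else canon L e (m + 1))"
| "act k ([], e, m) (c, False) = ([k - 1], other c, m - 1)"
| "act k (i # L, e, m) (c, False) =
     (if c \<noteq> e then ((k - 1) # i # L, e, m - 1)
      else if i > 1 then ((i - 1) # L, other e, m) else canon L e m)"

definition valid :: "nat \<Rightarrow> state \<Rightarrow> bool" where
  "valid k s \<longleftrightarrow> set (fst s) \<subseteq> {1..<k} \<and> s = canon (fst s) (fst (snd s)) (snd (snd s))"

definition run :: "nat \<Rightarrow> state \<Rightarrow> gen gword \<Rightarrow> state" where
  "run k s u = foldl (act k) s u"

abbreviation start :: state where
  "start \<equiv> ([], ga, 0)"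

lemma run_Nil [simp]: "run k s [] = s"
  and run_Cons [simp]: "run k s (l # u) = run k (act k s l) u"
  and run_append: "run k s (u @ v) = run k (run k s u) v"
  by (simp_all add: run_def)

lemma canon_Cons [simp]: "canon (i # L) e m = (i # L, e, m)"
  by (simp add: canon_def)

lemma fst_canon [simp]: "fst (canon L e m) = L"
  by (simp add: canon_def)

lemma valid_canon: "set L \<subseteq> {1..<k} \<Longrightarrow> valid k (canon L e m)"
  by (simp add: valid_def canon_def)

lemma valid_start [simp]: "valid k start"
  by (simp add: valid_def canon_def)

lemma valid_cases:
  assumes "valid k s"
  obtains m where "s = ([], ga, m)"
  | i L e m where "s = (i # L, e, m)" "1 \<le> i" "i < k" "set L \<subseteq> {1..<k}"
  using assms by (cases s; cases "fst s") (auto simp: valid_def canon_def)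

lemma valid_obtain_canon:
  assumes "valid k s"
  obtains L e m where "s = canon L e m" "set L \<subseteq> {1..<k}"
  using assms by (auto simp: valid_def)

lemma valid_act:
  assumes "k \<ge> 2" "valid k s"
  shows "valid k (act k s l)"
  using assms(2)
proof (cases rule: valid_cases)
  case (1 m)
  then show ?thesis using assms(1)
    by (cases l; cases "snd l") (auto simp: valid_def canon_def)
next
  case (2 i L e m)
  then show ?thesis using assms(1)
    by (cases l; cases "snd l") (auto simp: valid_def canon_def)
qed

lemma valid_run:
  assumes "k \<ge> 2" "valid k s"
  shows "valid k (run k s u)"
  using assms(2) by (induction u arbitrary: s) (auto simp: valid_act[OF assms(1)])

lemma act_canon_eq:
  "act k (canon L e m) (e, True) = (1 # L, e, m)"
  "act k (canon L e m) (other e, False) = ((k - 1) # L, e, m - 1)"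
  by (cases L; simp add: canon_def)+

text \<open>The moves are mutually inverse in pairs: appending a factor of length 1 is undone by
  erasing it, extending by shortening, and completing a factor to \<open>\<Delta>\<close> by
  appending one of length \<open>k - 1\<close>.\<close>

lemma act_cancel:
  assumes "k \<ge> 2" "valid k s"
  shows "act k (act k s (c, b)) (c, \<not> b) = s"
  using assms(2)
proof (cases rule: valid_cases)
  case (1 m)
  then show ?thesis using assms(1)
    by (cases b; cases c) (auto simp: canon_def)
next
  case (2 i L e m)
  show ?thesis
  proof (cases "c = e")
    case True
    then show ?thesis using assms(1) 2
      by (cases b) (auto simp: act_canon_eq)
  next
    case False
    then have "c = other e" by (simp add: eq_other_iff)
    then show ?thesis using assms(1) 2
      by (cases b) (auto simp: act_canon_eq)
  qed
qed

section \<open>The action of alternating words and of \<open>\<Delta>\<close>\<close>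

lemma run_push:
  "0 < i \<Longrightarrow> i < k \<Longrightarrow>
    run k (canon L e m) (pos (alt e (other e) i)) = (i # L, if odd i then e else other e, m)"
proof (induction i)
  case (Suc i)
  show ?case
  proof (cases "i = 0")
    case False
    with Suc show ?thesis
      by (auto simp del: alt.simps simp: alt_Suc_right run_append)
  qed (use Suc in \<open>simp add: act_canon_eq\<close>)
qed simp

lemma run_extend:
  "0 < i \<Longrightarrow> i + j < k \<Longrightarrow>
    run k (i # L, e, m) (pos (alt (other e) e j)) = ((i + j) # L, if odd j then other e else e, m)"
proof (induction j)
  case (Suc j)
  then show ?case
    by (auto simp del: alt.simps simp: alt_Suc_right run_append)
qed simp

lemma run_complete:
  assumes "0 < i" "0 < j" "i + j = k"
  shows "run k (i # L, e, m) (pos (alt (other e) e j)) = canon L (if even j then other e else e) (m + 1)"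
proof -
  obtain j' where j: "j = Suc j'" using assms by (cases j) auto
  then show ?thesis using assms run_extend[of i j' k L e m]
    by (auto simp del: alt.simps simp: alt_Suc_right run_append)
qed

text \<open>Conjugation by \<open>\<Delta>\<close>^m on the generators: it exchanges them exactly
  when both \<open>k\<close> and \<open>m\<close> are odd.\<close>

definition sig :: "nat \<Rightarrow> int \<Rightarrow> gen \<Rightarrow> gen" where
  "sig k m e = (if even k \<or> even m then e else other e)"

text \<open>In a state the power of \<open>\<Delta>\<close> stands in front, so a
  \<open>\<Delta>\<close> multiplied on the right has to pass all factors, which keeps their lengths
  and conjugates their letters.\<close>

definition Delta_act :: "nat \<Rightarrow> state \<Rightarrow> state" where
  "Delta_act k s = canon (fst s) (sig k 1 (fst (snd s))) (snd (snd s) + 1)"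

lemma sig_sig: "sig k m (sig k n e) = sig k (m + n) e"
  by (auto simp: sig_def)

lemma sig_0 [simp]: "sig k 0 e = e"
  by (simp add: sig_def)

lemma sig_inject [simp]: "sig k m c = sig k m d \<longleftrightarrow> c = d"
  by (simp add: sig_def)

lemma sig_other: "sig k m (other e) = other (sig k m e)"
  by (simp add: sig_def)

lemma run_Delta_canon:
  assumes k: "k \<ge> 2"
  shows "run k (canon L e m) (pos (alt e (other e) k)) = canon L (sig k 1 e) (m + 1)"
proof -
  obtain k' where k': "k = Suc k'" "k' > 0" using k by (cases k) auto
  then show ?thesis using run_push[of k' k L e m]
    by (auto simp del: alt.simps simp: alt_Suc_right run_append sig_def)
qed

text \<open>A word starting with the last letter of the state grows into a new factor that becomes
  \<open>\<Delta>\<close>. In the other case its first \<open>k - i\<close> letters complete the top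
  factor, and the remaining \<open>i\<close> letters rebuild a factor of length \<open>i\<close>.
  The result is the same for both starting letters, which is the defining relation.\<close>

lemma run_Delta:
  assumes k: "k \<ge> 2" and "valid k s"
  shows "run k s (pos (alt c (other c) k)) = Delta_act k s"
  using assms(2)
proof (cases rule: valid_cases)
  case (1 m)
  then show ?thesis using run_Delta_canon[OF k, of "[]" c m]
    by (simp add: Delta_act_def canon_def)
next
  case (2 i L e m)
  show ?thesis
  proof (cases "c = e")
    case True
    then show ?thesis using run_Delta_canon[OF k, of "i # L" e m] 2 by (simp add: Delta_act_def)
  next
    case False
    then have c: "c = other e" by (simp add: eq_other_iff)
    define j where "j = k - i"
    have kj: "k = j + i" "0 < j" using 2 by (auto simp: j_def)
    define f where "f = (if even j then other e else e)"
    have "alt c (other c) k = alt (other e) e j @ alt f (other f) i"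
      unfolding kj c by (simp add: alt_add f_def)
    moreover have "run k (i # L, e, m) (pos (alt (other e) e j)) = canon L f (m + 1)"
      unfolding f_def using run_complete[of i j k L e m] 2 kj by simp
    moreover have "run k (canon L f (m + 1)) (pos (alt f (other f) i))
        = (i # L, if odd i then f else other f, m + 1)"
      using 2 by (intro run_push) auto
    ultimately show ?thesis using 2 kj
      by (auto simp: run_append Delta_act_def sig_def f_def)
  qed
qed

text \<open>Opposite letters act as inverses and both sides of the Artin relation act as
  \<open>Delta_act\<close>, so the action factors through the group. This is what later separates
  different normal forms.\<close>

lemma run_cong:
  assumes "k \<ge> 2" "pres_eq (artin_rels k) u v" "valid k s"
  shows "run k s u = run k s v"
  using assms(2,3)
proof (induction arbitrary: s rule: pres_eq.induct)
  case (in_context u v p q)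
  then show ?case by (simp add: run_append valid_run[OF assms(1)])
next
  case (cancel x e)
  then show ?case using act_cancel[OF assms(1), of s x e] by simp
next
  case (rel u v)
  then have "u = pos (alt ga (other ga) k)" "v = pos (alt gb (other gb) k)"
    by (simp_all add: artin_rels_def)
  then show ?case using run_Delta[OF assms(1) rel(2)] by metis
qed auto

section \<open>Garside normal forms\<close>

locale dihedral_artin =
  fixes k :: nat
  assumes k2: "k \<ge> 2"
begin

abbreviation cls :: "gen gword \<Rightarrow> gen gword set" where
  "cls \<equiv> word_class (artin_rels k)"

sublocale group "artin k"
  unfolding artin_def by (rule group_presented_group)

lemma carrier_artin: "carrier (artin k) = range cls"
  and one_artin: "\<one>\<^bsub>artin k\<^esub> = cls []"
  by (simp_all add: artin_def presented_group_def)

lemma mult_cls: "cls u \<otimes>\<^bsub>artin k\<^esub> cls v = cls (u @ v)"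
  unfolding artin_def by (rule mult_word_class)

lemma cls_closed [simp]: "cls u \<in> carrier (artin k)"
  by (simp add: carrier_artin)

lemma gprod_cls: "gprod (artin k) (map cls us) = cls (concat us)"
  by (induction us) (simp_all add: gprod_def one_artin mult_cls)

lemma inv_gen_elt: "inv\<^bsub>artin k\<^esub> gen_elt k c = cls [(c, False)]"
proof (rule inv_equality)
  show "cls [(c, False)] \<otimes>\<^bsub>artin k\<^esub> gen_elt k c = \<one>\<^bsub>artin k\<^esub>"
    using pres_eq.cancel[of _ c False] by (simp add: gen_elt_def mult_cls one_artin word_class_eq_iff)
qed (simp_all add: gen_elt_def)

lemma gen_elt_closed [simp]: "gen_elt k c \<in> carrier (artin k)"
  and pos_elt_closed [simp]: "pos_elt k w \<in> carrier (artin k)"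
  and Delta_closed [simp]: "Delta k \<in> carrier (artin k)"
  by (simp_all add: gen_elt_def pos_elt_def Delta_def)

lemma pos_elt_append: "pos_elt k (u @ v) = pos_elt k u \<otimes>\<^bsub>artin k\<^esub> pos_elt k v"
  by (simp add: pos_elt_def mult_cls)

lemma gen_elt_eq: "gen_elt k c = pos_elt k [c]"
  by (simp add: gen_elt_def pos_elt_def)

lemma Delta_eq: "pos_elt k (alt c (other c) k) = Delta k"
proof (cases c)
  case gb
  have "pres_eq (artin_rels k) (pos (alt ga gb k)) (pos (alt gb ga k))"
    by (rule pres_eq.rel) (simp add: artin_rels_def)
  then show ?thesis using gb by (simp add: pos_elt_def Delta_def word_class_eq_iff pres_eq.sym)
qed (simp add: Delta_def)

text \<open>The alternating word of length \<open>k + 1\<close> has \<open>\<Delta>\<close> both as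
  a prefix and as a suffix.\<close>

lemma Delta_gen: "Delta k \<otimes>\<^bsub>artin k\<^esub> gen_elt k c = gen_elt k (sig k 1 c) \<otimes>\<^bsub>artin k\<^esub> Delta k"
proof -
  define d where "d = sig k 1 c"
  have c: "c = (if even k then d else other d)" by (simp add: d_def sig_def)
  have "gen_elt k d \<otimes>\<^bsub>artin k\<^esub> Delta k = pos_elt k (alt d (other d) (Suc k))"
    using Delta_eq[of "other d"] pos_elt_append[of "[d]" "alt (other d) d k"]
    by (simp add: gen_elt_eq)
  also have "\<dots> = Delta k \<otimes>\<^bsub>artin k\<^esub> gen_elt k c"
    unfolding alt_Suc_right c by (simp add: gen_elt_eq pos_elt_append Delta_eq)
  finally show ?thesis by (simp add: d_def)
qed

lemma Delta_pow_Suc: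
  "Delta k [^]\<^bsub>artin k\<^esub> (m + 1 :: int) = Delta k [^]\<^bsub>artin k\<^esub> m \<otimes>\<^bsub>artin k\<^esub> Delta k"
  "Delta k [^]\<^bsub>artin k\<^esub> (m + 1 :: int) = Delta k \<otimes>\<^bsub>artin k\<^esub> Delta k [^]\<^bsub>artin k\<^esub> m"
  using int_pow_mult[of "Delta k" m 1] int_pow_mult[of "Delta k" 1 m] by (simp_all add: add.commute)

lemma Delta_pow_gen:
  "Delta k [^]\<^bsub>artin k\<^esub> (m::int) \<otimes>\<^bsub>artin k\<^esub> gen_elt k c
     = gen_elt k (sig k m c) \<otimes>\<^bsub>artin k\<^esub> Delta k [^]\<^bsub>artin k\<^esub> m"
proof (induction m arbitrary: c rule: int_induct[where k = 0])
  case base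
  then show ?case by simp
next
  case (step1 m)
  have "Delta k [^]\<^bsub>artin k\<^esub> (m + 1) \<otimes>\<^bsub>artin k\<^esub> gen_elt k c
      = Delta k [^]\<^bsub>artin k\<^esub> m \<otimes>\<^bsub>artin k\<^esub> gen_elt k (sig k 1 c) \<otimes>\<^bsub>artin k\<^esub> Delta k"
    by (simp add: Delta_pow_Suc(1) m_assoc Delta_gen)
  also have "\<dots> = gen_elt k (sig k (m + 1) c) \<otimes>\<^bsub>artin k\<^esub> Delta k [^]\<^bsub>artin k\<^esub> (m + 1)"
    by (simp add: step1 Delta_pow_Suc(1) m_assoc sig_sig)
  finally show ?case .
next
  case (step2 m)
  let ?D = "Delta k [^]\<^bsub>artin k\<^esub> (m - 1)"
  \<comment> \<open>Passing through \<open>\<Delta>\<close> turns \<open>c\<close> into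
    \<open>d\<close>, so after multiplication by \<open>\<Delta>\<close> on the right the claim for
    \<open>m - 1\<close> becomes the one for \<open>m\<close>.\<close>
  define d where "d = sig k 1 c"
  have c: "c = sig k 1 d" by (simp add: d_def sig_def)
  have D: "?D \<otimes>\<^bsub>artin k\<^esub> Delta k = Delta k [^]\<^bsub>artin k\<^esub> m"
    using Delta_pow_Suc(1)[of "m - 1"] by simp
  have "?D \<otimes>\<^bsub>artin k\<^esub> gen_elt k c \<otimes>\<^bsub>artin k\<^esub> Delta k = ?D \<otimes>\<^bsub>artin k\<^esub> Delta k \<otimes>\<^bsub>artin k\<^esub> gen_elt k d"
    by (simp add: m_assoc Delta_gen c)
  also have "\<dots> = gen_elt k (sig k m d) \<otimes>\<^bsub>artin k\<^esub> (?D \<otimes>\<^bsub>artin k\<^esub> Delta k)"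
    unfolding D by (rule step2.IH)
  also have "\<dots> = gen_elt k (sig k (m - 1) c) \<otimes>\<^bsub>artin k\<^esub> ?D \<otimes>\<^bsub>artin k\<^esub> Delta k"
    by (simp add: m_assoc c sig_sig)
  finally show ?case by (subst (asm) right_cancel) auto
qed

end

text \<open>Rebuilds the factors from their lengths: \<open>f\<close> is the first letter of the
  factor of length \<open>i\<close> that ends in \<open>e\<close>, and by linking it is also the
  last letter of the factors before it.\<close>

fun nf_words :: "nat list \<Rightarrow> gen \<Rightarrow> gen list list" where
  "nf_words [] e = []"
| "nf_words (i # L) e =
     (let f = if odd i then e else other e in nf_words L f @ [alt f (other f) i])"

definition linked :: "gen list list \<Rightarrow> bool" where
  "linked ts \<longleftrightarrow> (\<forall>i. Suc i < length ts \<longrightarrow> last (ts ! i) = hd (ts ! Suc i))"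

lemma linked_Nil [simp]: "linked []"
  by (simp add: linked_def)

lemma linked_snoc: "linked (ts @ [t]) \<longleftrightarrow> linked ts \<and> (ts \<noteq> [] \<longrightarrow> last (last ts) = hd t)"
proof -
  have "linked (ts @ [t]) \<longleftrightarrow>
    (\<forall>i. Suc i < length ts \<longrightarrow> last (ts ! i) = hd (ts ! Suc i)) \<and>
    (\<forall>i. Suc i = length ts \<longrightarrow> last (ts ! i) = hd t)"
    unfolding linked_def by (auto simp: nth_append less_Suc_eq)
  also have "(\<forall>i. Suc i = length ts \<longrightarrow> last (ts ! i) = hd t) \<longleftrightarrow> (ts \<noteq> [] \<longrightarrow> last (last ts) = hd t)"
    by (cases ts rule: rev_cases) auto
  finally show ?thesis by (simp add: linked_def)
qed

lemma T_words_iff: "t \<in> T_words k \<longleftrightarrow> (\<exists>f i. t = alt f (other f) i \<and> 1 \<le> i \<and> i < k)"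
proof -
  have "(\<exists>f. P f) \<longleftrightarrow> P ga \<or> P gb" for P
    by (metis gen.exhaust)
  then show ?thesis by (auto simp: T_words_def)
qed

lemma alt_in_T_words: "1 \<le> i \<Longrightarrow> i < k \<Longrightarrow> alt f (other f) i \<in> T_words k"
  by (auto simp: T_words_iff)

lemma length_nf_words [simp]: "length (nf_words L e) = length L"
  by (induction L e rule: nf_words.induct) (simp_all add: Let_def)

lemma last_nf_words: "L \<noteq> [] \<Longrightarrow> 0 \<notin> set L \<Longrightarrow> last (last (nf_words L e)) = e"
  by (cases L) (auto simp: Let_def last_alt)

lemma nf_words_subset: "set L \<subseteq> {1..<k} \<Longrightarrow> set (nf_words L e) \<subseteq> T_words k"
proof (induction L e rule: nf_words.induct)
  case (2 i L e)
  have "alt (other e) e i \<in> T_words k"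
    using alt_in_T_words[of i k "other e"] 2 by simp
  with 2 show ?case by (simp add: Let_def alt_in_T_words)
qed simp

lemma linked_nf_words: "0 \<notin> set L \<Longrightarrow> linked (nf_words L e)"
proof (induction L e rule: nf_words.induct)
  case (2 i L e)
  have "nf_words L f \<noteq> [] \<longleftrightarrow> L \<noteq> []" for f
    by (metis length_nf_words length_0_conv)
  with 2 show ?case
    by (simp add: Let_def linked_snoc last_nf_words hd_alt del: alt.simps)
qed simp

text \<open>Linking leaves only the lengths and the final letter free, and running the factors
  pushes them one after the other, so the action reads the normal form off. For empty
  \<open>ts\<close> the letter \<open>last (last ts)\<close> is unspecified, but
  \<open>nf_words\<close> and \<open>canon\<close> ignore it.\<close>

lemma nf_words_unique:
  "set ts \<subseteq> T_words k \<Longrightarrow> linked ts \<Longrightarrow>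
     ts = nf_words (rev (map length ts)) (last (last ts)) \<and>
     run k start (pos (concat ts)) = canon (rev (map length ts)) (last (last ts)) 0"
proof (induction ts rule: rev_induct)
  case (snoc t ts)
  obtain f i where t: "t = alt f (other f) i" "1 \<le> i" "i < k"
    using snoc.prems(1) by (auto simp: T_words_iff)
  let ?L = "rev (map length ts)"
  have IH: "ts = nf_words ?L (last (last ts))"
    "run k start (pos (concat ts)) = canon ?L (last (last ts)) 0"
    using snoc by (auto simp: linked_snoc)
  have "ts = nf_words ?L f \<and> canon ?L (last (last ts)) 0 = canon ?L f 0"
  proof (cases "ts = []")
    case False
    then have "last (last ts) = f"
      using snoc.prems(2) t by (auto simp: linked_snoc hd_alt)
    then show ?thesis using IH by simp
  qed (simp add: canon_def)
  moreover have "run k (canon ?L f 0) (pos t) = (i # ?L, last t, 0)"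
    using t run_push[of i k ?L f 0] by (simp add: last_alt)
  moreover have "nf_words (i # ?L) (last t) = nf_words ?L f @ [t]"
    using t by (simp add: Let_def last_alt)
  ultimately show ?case using IH t by (simp add: run_append)
qed (simp add: canon_def)

section \<open>Translation between states and group elements\<close>

context dihedral_artin
begin

text \<open>The Garside form has its power of \<open>\<Delta>\<close> at the end, a state has it in
  front; moving it across conjugates the last letter by \<open>sig k m\<close>.\<close>

definition elt :: "state \<Rightarrow> gen gword set" where
  "elt = (\<lambda>(L, e, m). pos_elt k (concat (nf_words L (sig k m e)))
      \<otimes>\<^bsub>artin k\<^esub> Delta k [^]\<^bsub>artin k\<^esub> m)"

lemma elt_closed [simp]: "elt s \<in> carrier (artin k)"
  by (simp add: elt_def split: prod.splits)

lemma elt_start: "elt start = \<one>\<^bsub>artin k\<^esub>"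
  by (simp add: elt_def pos_elt_def one_artin mult_cls)

lemma elt_mult_gen:
  "elt (L, e, m) \<otimes>\<^bsub>artin k\<^esub> gen_elt k c =
     pos_elt k (concat (nf_words L (sig k m e)) @ [sig k m c]) \<otimes>\<^bsub>artin k\<^esub> Delta k [^]\<^bsub>artin k\<^esub> m"
  by (simp add: elt_def m_assoc Delta_pow_gen) (simp add: gen_elt_eq pos_elt_append m_assoc)

lemma elt_act_pos:
  assumes "valid k s"
  shows "elt (act k s (c, True)) = elt s \<otimes>\<^bsub>artin k\<^esub> gen_elt k c"
  using assms
proof (cases rule: valid_cases)
  case (1 m)
  then show ?thesis by (simp add: elt_mult_gen) (simp add: elt_def Let_def)
next
  case (2 i L e m)
  let ?e = "sig k m e"
  define f where "f = (if odd i then ?e else other ?e)"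
  have words: "concat (nf_words (i # L) ?e) = concat (nf_words L f) @ alt f (other f) i"
    by (simp add: f_def Let_def)
  show ?thesis
  proof (cases "c = e")
    case True
    with 2 show ?thesis by (simp add: elt_mult_gen) (simp add: elt_def Let_def)
  next
    case False
    then have c: "c = other e" by (simp add: eq_other_iff)
    have ext: "alt f (other f) (Suc i) = alt f (other f) i @ [sig k m c]"
      by (simp add: alt_Suc_right f_def c sig_other del: alt.simps)
    have prod: "elt s \<otimes>\<^bsub>artin k\<^esub> gen_elt k c
        = pos_elt k (concat (nf_words L f) @ alt f (other f) (Suc i)) \<otimes>\<^bsub>artin k\<^esub> Delta k [^]\<^bsub>artin k\<^esub> m"
      unfolding 2 elt_mult_gen words ext by simp
    show ?thesis
    proof (cases "Suc i < k")
      case True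
      have "concat (nf_words (Suc i # L) (sig k m c)) = concat (nf_words L f) @ alt f (other f) (Suc i)"
        by (auto simp: Let_def f_def c sig_other simp del: alt.simps)
      then show ?thesis using True False prod 2 by (simp add: elt_def del: alt.simps nf_words.simps)
    next
      case False
      then have k: "k = Suc i" using 2 by simp
      \<comment> \<open>The factors below the completed one end in its first letter
        \<open>f\<close>; relative to the exponent \<open>m + 1\<close> this is the letter stored by
        \<open>canon\<close>.\<close>
      have "nf_words L f = nf_words L (sig k (m + 1) (if L = [] then ga else e))"
      proof (cases "L = []")
        case False
        have "f = sig k (1 + m) e"
          unfolding sig_sig[symmetric] f_def by (simp add: sig_def k)
        then show ?thesis using False by (simp add: add.commute)
      qed simp
      moreover have "pos_elt k (alt f (other f) (Suc i)) = Delta k"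
        using Delta_eq[of f] k by simp
      ultimately show ?thesis using False \<open>c \<noteq> e\<close> 2 prod
        by (simp add: elt_def canon_def pos_elt_append m_assoc Delta_pow_Suc(2) del: alt.simps)
    qed
  qed
qed

lemma elt_act:
  assumes "valid k s"
  shows "elt (act k s l) = elt s \<otimes>\<^bsub>artin k\<^esub> cls [l]"
proof -
  obtain c b where l: "l = (c, b)" by force
  show ?thesis
  proof (cases b)
    case True
    then show ?thesis using elt_act_pos[OF assms, of c] l by (simp add: gen_elt_def)
  next
    case False
    let ?s = "act k s (c, False)"
    have "elt s = elt (act k ?s (c, True))"
      using act_cancel[OF k2 assms, of c False] by simp
    also have "\<dots> = elt ?s \<otimes>\<^bsub>artin k\<^esub> gen_elt k c"
      by (rule elt_act_pos[OF valid_act[OF k2 assms]])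
    finally show ?thesis using l False
      by (simp add: inv_gen_elt[symmetric] m_assoc)
  qed
qed

lemma elt_run:
  assumes "valid k s"
  shows "elt (run k s u) = elt s \<otimes>\<^bsub>artin k\<^esub> cls u"
  using assms
proof (induction u arbitrary: s)
  case Nil
  then show ?case by (simp add: one_artin[symmetric])
next
  case (Cons l u)
  then show ?case using mult_cls[of "[l]" u]
    by (simp add: valid_act[OF k2] elt_act m_assoc)
qed

lemma elt_run_start: "elt (run k start u) = cls u"
  by (simp add: elt_run elt_start)

text \<open>This solves the word problem: \<open>elt\<close> recovers the element from the state,
  and \<open>run_cong\<close> shows that the state depends only on the element.\<close>

lemma run_start_eq_iff: "run k start u = run k start v \<longleftrightarrow> cls u = cls v"
proof
  show "run k start u = run k start v \<Longrightarrow> cls u = cls v"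
    by (metis elt_run_start)
  show "cls u = cls v \<Longrightarrow> run k start u = run k start v"
    using run_cong[OF k2 _ valid_start] by (simp add: word_class_eq_iff)
qed

lemma gprod_pos_elt: "gprod (artin k) (map (pos_elt k) ts) = pos_elt k (concat ts)"
proof -
  have "gprod (artin k) (map (pos_elt k) ts) = gprod (artin k) (map cls (map pos ts))"
    by (simp add: pos_elt_def[abs_def] comp_def)
  also have "\<dots> = pos_elt k (concat ts)"
    unfolding gprod_cls pos_elt_def by (simp add: pos_def[abs_def] map_concat)
  finally show ?thesis .
qed

lemma is_garside_nf_iff:
  "is_garside_nf k g ts m \<longleftrightarrow> set ts \<subseteq> T_words k \<and> linked ts \<and>
     g = pos_elt k (concat ts) \<otimes>\<^bsub>artin k\<^esub> Delta k [^]\<^bsub>artin k\<^esub> m"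
  by (auto simp: is_garside_nf_def linked_def gprod_pos_elt)

lemma Delta_act_canon: "Delta_act k (canon L e m) = canon L (sig k 1 e) (m + 1)"
  by (simp add: Delta_act_def canon_def)

lemma run_Delta_pow:
  assumes "run k start u = canon L e 0" "cls v = cls u \<otimes>\<^bsub>artin k\<^esub> Delta k [^]\<^bsub>artin k\<^esub> (m::int)"
  shows "run k start v = canon L (sig k m e) m"
  using assms(2)
proof (induction m arbitrary: v rule: int_induct[where k = 0])
  case base
  then show ?case using assms(1) run_start_eq_iff[of v u] by simp
next
  case (step1 m)
  have "cls u \<otimes>\<^bsub>artin k\<^esub> Delta k [^]\<^bsub>artin k\<^esub> m \<in> range cls"
    unfolding carrier_artin[symmetric] by simp
  then obtain w where w: "cls w = cls u \<otimes>\<^bsub>artin k\<^esub> Delta k [^]\<^bsub>artin k\<^esub> m"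
    by (metis rangeE)
  have "cls v = cls w \<otimes>\<^bsub>artin k\<^esub> Delta k"
    using step1.prems w by (simp add: Delta_pow_Suc(1) m_assoc)
  also have "\<dots> = cls (w @ pos (alt ga gb k))"
    by (simp add: Delta_def pos_elt_def mult_cls)
  finally have "run k start v = run k start (w @ pos (alt ga gb k))"
    by (rule iffD2[OF run_start_eq_iff])
  then have "run k start v = Delta_act k (run k start w)"
    using run_Delta[OF k2 valid_run[OF k2 valid_start], of _ ga]
    by (simp add: run_append)
  then show ?case using step1.IH[OF w] by (simp add: Delta_act_canon sig_sig add.commute)
next
  case (step2 m)
  \<comment> \<open>In the downward step \<open>\<Delta>\<close> is appended to \<open>v\<close>,
    the induction hypothesis gives the resulting state, and \<open>Delta_act\<close> is then
    inverted.\<close>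
  have "cls (v @ pos (alt ga gb k)) = cls v \<otimes>\<^bsub>artin k\<^esub> Delta k"
    by (simp add: Delta_def pos_elt_def mult_cls)
  also have "\<dots> = cls u \<otimes>\<^bsub>artin k\<^esub> Delta k [^]\<^bsub>artin k\<^esub> m"
    using step2.prems Delta_pow_Suc(1)[of "m - 1"] by (simp add: m_assoc)
  finally have "run k start (v @ pos (alt ga gb k)) = canon L (sig k m e) m"
    by (rule step2.IH)
  then have *: "Delta_act k (run k start v) = canon L (sig k m e) m"
    using run_Delta[OF k2 valid_run[OF k2 valid_start], of _ ga]
    by (simp add: run_append)
  obtain L' e' m' where v: "run k start v = canon L' e' m'"
    using valid_obtain_canon[OF valid_run[OF k2 valid_start]] by metis
  have "sig k m e = sig k 1 (sig k (m - 1) e)" by (simp add: sig_sig)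
  with * have "canon L' (sig k 1 e') (m' + 1) = canon L (sig k 1 (sig k (m - 1) e)) m"
    by (simp add: v Delta_act_canon)
  then show ?case by (auto simp: v canon_def)
qed

text \<open>The state itself supplies a normal form through \<open>elt\<close>. Any other normal
  form of the element leads to the same state, which fixes the lengths, the last letter and the
  exponent.\<close>

lemma garside_nf_cls:
  assumes u: "run k start u = (L, e, m)"
  shows "garside_nf k (cls u) = (nf_words L (sig k m e), m)"
  unfolding garside_nf_def
proof (rule the_equality)
  have "valid k (L, e, m)" using valid_run[OF k2 valid_start] u by metis
  then have L: "set L \<subseteq> {1..<k}" by (simp add: valid_def)
  then have "0 \<notin> set L" by auto
  with L have nf: "is_garside_nf k (cls u) (nf_words L (sig k m e)) m"
    using elt_run_start[of u] u nf_words_subset linked_nf_words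
    by (simp add: is_garside_nf_iff elt_def)
  then show "is_garside_nf k (cls u) (fst (nf_words L (sig k m e), m)) (snd (nf_words L (sig k m e), m))"
    by simp
  have state: "run k start u = canon (rev (map length ts)) (sig k n (last (last ts))) n"
    if "is_garside_nf k (cls u) ts n" for ts n
    using that nf_words_unique[of ts k] unfolding is_garside_nf_iff pos_elt_def
    by (intro run_Delta_pow) auto
  fix p assume p: "is_garside_nf k (cls u) (fst p) (snd p)"
  obtain ts n where ts: "p = (ts, n)" by force
  let ?ts = "nf_words L (sig k m e)"
  have nf': "is_garside_nf k (cls u) ts n" using p ts by simp
  have eq: "canon (rev (map length ts)) (sig k n (last (last ts))) n
      = canon (rev (map length ?ts)) (sig k m (last (last ?ts))) m"
    using state[OF nf] state[OF nf'] by simp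
  then have nm: "n = m" and len: "rev (map length ts) = rev (map length ?ts)"
    by (simp_all add: canon_def)
  have "ts = nf_words (rev (map length ts)) (last (last ts))"
    "?ts = nf_words (rev (map length ?ts)) (last (last ?ts))"
    using nf nf' nf_words_unique unfolding is_garside_nf_iff by blast+
  moreover have "nf_words (rev (map length ts)) (last (last ts))
      = nf_words (rev (map length ?ts)) (last (last ?ts))"
  proof (cases "ts = []")
    case True
    then show ?thesis using len by simp
  next
    case False
    then have "?ts \<noteq> []" using len by auto
    then have "last (last ts) = last (last ?ts)"
      using eq nm len by (simp add: canon_def)
    then show ?thesis using len by simp
  qed
  ultimately show "p = (nf_words L (sig k m e), m)" using ts nm by simp
qed

lemma T_length_cls: "T_length k (cls u) = length (fst (run k start u))"
  by (cases "run k start u") (simp add: T_length_def garside_nf_cls)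

lemma Delta_exp_cls: "Delta_exp k (cls u) = snd (snd (run k start u))"
  by (cases "run k start u") (simp add: Delta_exp_def garside_nf_cls)

end

section \<open>Word length\<close>

text \<open>A factor of length \<open>i\<close> can be made by \<open>i\<close> positive letters, or
  by \<open>k - i\<close> inverse letters together with one factor \<open>\<Delta>\<close>^-1; the
  cheaper cost is counted.\<close>

definition fold_length :: "nat \<Rightarrow> nat list \<Rightarrow> nat" where
  "fold_length k L = sum_list (map (\<lambda>i. min i (k - i)) L)"

text \<open>Counts the factors that are cheaper to make by inverse letters, a tie as one half. The
  negated sum is, up to rounding, the exponent of \<open>\<Delta>\<close> that comes at no extra
  cost.\<close>

definition half :: "nat \<Rightarrow> nat \<Rightarrow> real" where
  "half k i = (if 2 * i > k then 1 else if 2 * i = k then 1 / 2 else 0)"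

section \<open>Lower and upper bounds for the word length\<close>

context dihedral_artin
begin

lemma nat_gens_eq: "nat_gens k = range (\<lambda>l. cls [l])"
proof -
  have UNIV: "UNIV = {(ga, True), (gb, True), (ga, False), (gb, False)}"
    by (auto intro: gen.exhaust)
  have "nat_gens k = (\<lambda>l. cls [l]) ` {(ga, True), (gb, True), (ga, False), (gb, False)}"
    by (simp add: nat_gens_def inv_gen_elt) (simp add: gen_elt_def)
  then show ?thesis by (simp only: UNIV)
qed

lemma S_length_cls: "S_length k (cls u) = (LEAST n. \<exists>v. length v = n \<and> cls v = cls u)"
proof -
  have gprod: "gprod (artin k) (map (\<lambda>l. cls [l]) v) = cls v" for v
    using gprod_cls[of "map (\<lambda>l. [l]) v"] by (simp add: comp_def)
  have "(\<exists>ss. set ss \<subseteq> nat_gens k \<and> length ss = n \<and> gprod (artin k) ss = cls u)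
      \<longleftrightarrow> (\<exists>v. length v = n \<and> cls v = cls u)" for n
  proof safe
    fix ss assume "set ss \<subseteq> nat_gens k" "gprod (artin k) ss = cls u"
    moreover from this obtain v where "ss = map (\<lambda>l. cls [l]) v"
      using ex_map_conv[of ss "\<lambda>l. cls [l]"] unfolding nat_gens_eq by blast
    ultimately show "\<exists>v. length v = length ss \<and> cls v = cls u"
      by (auto simp: gprod)
  next
    fix v assume "cls v = cls u"
    then show "\<exists>ss. set ss \<subseteq> nat_gens k \<and> length ss = length v \<and> gprod (artin k) ss = cls u"
      by (intro exI[of _ "map (\<lambda>l. cls [l]) v"]) (auto simp: gprod nat_gens_eq)
  qed
  then show ?thesis by (simp add: S_length_def word_length_def)
qed

lemma S_length_le: "cls v = cls u \<Longrightarrow> S_length k (cls u) \<le> length v"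
  unfolding S_length_cls by (rule Least_le) auto

lemma S_length_attained:
  obtains v where "length v = S_length k (cls u)" "cls v = cls u"
  using LeastI[of "\<lambda>n. \<exists>v. length v = n \<and> cls v = cls u" "length u"] that
  unfolding S_length_cls by blast

text \<open>A new factor costs \<open>min 1 (k - 1) = 1\<close>, and moving a length by one changes
  its folded value by at most one.\<close>

lemma fold_length_act:
  assumes "valid k s"
  shows "fold_length k (fst (act k s l)) \<le> fold_length k (fst s) + 1"
proof -
  obtain c b where l: "l = (c, b)" by force
  show ?thesis using assms
  proof (cases rule: valid_cases)
    case (1 m)
    then show ?thesis using k2 by (cases b) (auto simp: l fold_length_def)
  next
    case (2 i L e m)
    then show ?thesis using k2 by (cases b) (auto simp: l fold_length_def canon_def)
  qed
qed

lemma fold_length_run: "valid k s \<Longrightarrow> fold_length k (fst (run k s u)) \<le> fold_length k (fst s) + length u"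
proof (induction u arbitrary: s)
  case (Cons l u)
  from Cons.IH[OF valid_act[OF k2 Cons.prems], of l] fold_length_act[OF Cons.prems, of l]
  show ?case by simp
qed simp

lemma fold_length_le_S_length: "fold_length k (fst (run k start u)) \<le> S_length k (cls u)"
proof -
  obtain v where v: "length v = S_length k (cls u)" "cls v = cls u"
    by (rule S_length_attained)
  then have "run k start u = run k start v" by (simp add: run_start_eq_iff)
  then show ?thesis using fold_length_run[OF valid_start, of v] v by (simp add: fold_length_def)
qed

text \<open>Counterpart of \<open>run_push\<close> for inverse letters: the first one creates a
  factor of length \<open>k - 1\<close> and lowers the exponent, each further one shortens that
  factor.\<close>

lemma run_pull:
  "0 < j \<Longrightarrow> j < k \<Longrightarrow>
    \<exists>w. length w = j \<and> run k (canon L e m) w = ((k - j) # L, if odd j then e else other e, m - 1)"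
proof (induction j)
  case (Suc j)
  show ?case
  proof (cases "j = 0")
    case True
    then show ?thesis
      by (intro exI[of _ "[(other e, False)]"]) (simp add: act_canon_eq)
  next
    case False
    with Suc obtain w where w: "length w = j"
      "run k (canon L e m) w = ((k - j) # L, if odd j then e else other e, m - 1)"
      by auto
    show ?thesis
      using w Suc.prems False
      by (intro exI[of _ "w @ [(if odd j then e else other e, False)]"]) (auto simp: run_append)
  qed
qed simp

text \<open>Each factor is made in its cheaper way. The exponent \<open>m\<close> is chosen before
  the letter \<open>e\<close>, because the next factor prescribes which last letter it
  needs.\<close>

lemma reach_canon:
  "set L \<subseteq> {1..<k} \<Longrightarrow>
    \<exists>m. \<bar>real_of_int m + sum_list (map (half k) L)\<bar> \<le> 1 / 2 \<and>
      (\<forall>e. \<exists>v. run k start v = canon L e m \<and> length v \<le> fold_length k L)"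
proof (induction L)
  case Nil
  show ?case
    by (intro exI[of _ 0] conjI allI exI[of _ "[]"]) (simp_all add: canon_def fold_length_def)
next
  case (Cons i L)
  then have i: "1 \<le> i" "i < k" "set L \<subseteq> {1..<k}" by auto
  from Cons.IH[OF i(3)] obtain m where m: "\<bar>real_of_int m + sum_list (map (half k) L)\<bar> \<le> 1 / 2"
    and reach: "\<And>e. \<exists>v. run k start v = canon L e m \<and> length v \<le> fold_length k L" by auto
  have push: "\<exists>v. run k start v = (i # L, e, m) \<and> length v \<le> fold_length k L + i" for e
  proof -
    define f where "f = (if odd i then e else other e)"
    obtain v where v: "run k start v = canon L f m" "length v \<le> fold_length k L"
      using reach by auto
    then show ?thesis using run_push[of i k L f m] i
      by (intro exI[of _ "v @ pos (alt f (other f) i)"]) (auto simp: run_append f_def)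
  qed
  have pull: "\<exists>v. run k start v = (i # L, e, m - 1) \<and> length v \<le> fold_length k L + (k - i)" for e
  proof -
    define f where "f = (if odd (k - i) then e else other e)"
    obtain v where v: "run k start v = canon L f m" "length v \<le> fold_length k L"
      using reach by auto
    obtain w where "length w = k - i"
      "run k (canon L f m) w = ((k - (k - i)) # L, if odd (k - i) then f else other f, m - 1)"
      using run_pull[of "k - i" L f m] i by auto
    moreover have "(if odd (k - i) then f else other f) = e" by (simp add: f_def)
    ultimately show ?thesis using v i
      by (intro exI[of _ "v @ w"]) (simp add: run_append)
  qed
  let ?S = "real_of_int m + sum_list (map (half k) L)"
  \<comment> \<open>For \<open>2 * i = k\<close> both ways cost the same, and the sign of
    \<open>?S\<close> decides; its change by 1/2 then keeps it within 1/2 of zero.\<close>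
  consider "2 * i < k \<or> 2 * i = k \<and> ?S \<le> 0" | "2 * i > k \<or> 2 * i = k \<and> ?S > 0" by linarith
  then show ?case
  proof cases
    case 1
    then have "fold_length k (i # L) = fold_length k L + i" by (auto simp: fold_length_def)
    moreover have "half k i = (if 2 * i = k then 1 / 2 else 0)" using 1 by (auto simp: half_def)
    ultimately show ?thesis using push m 1
      by (intro exI[of _ m]) auto
  next
    case 2
    then have "fold_length k (i # L) = fold_length k L + (k - i)" by (auto simp: fold_length_def)
    moreover have "half k i = (if 2 * i = k then 1 / 2 else 1)" using 2 by (auto simp: half_def)
    ultimately show ?thesis using pull m 2
      by (intro exI[of _ "m - 1"]) auto
  qed
qed

lemma run_inverse:
  assumes "valid k s"
  shows "run k (run k s u) (rev (map (\<lambda>(c, b). (c, \<not> b)) u)) = s"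
  using assms
proof (induction u arbitrary: s)
  case (Cons l u)
  obtain c b where l: "l = (c, b)" by force
  show ?case
    using Cons.IH[OF valid_act[OF k2 Cons.prems], of l] act_cancel[OF k2 Cons.prems, of c b]
    by (simp add: run_append l)
qed simp

lemma run_Delta_power:
  assumes "set L \<subseteq> {1..<k}"
  shows "\<exists>w. length w = k * n \<and> run k (canon L e m) w = canon L (sig k (int n) e) (m + int n)"
proof (induction n)
  case 0
  then show ?case by simp
next
  case (Suc n)
  then obtain w where "length w = k * n"
    "run k (canon L e m) w = canon L (sig k (int n) e) (m + int n)" by blast
  then show ?case
    using run_Delta[OF k2 valid_canon[OF assms], of _ _ ga]
    by (intro exI[of _ "w @ pos (alt ga (other ga) k)"])
      (simp add: run_append Delta_act_canon sig_sig add_ac)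
qed

text \<open>Each unit of the exponent costs the \<open>k\<close> letters of one
  \<open>\<Delta>\<close>; a downward shift is the formal inverse of an upward one. The starting
  letter \<open>e'\<close> is chosen to compensate the conjugation.\<close>

lemma run_Delta_shift:
  assumes "set L \<subseteq> {1..<k}"
  shows "\<exists>w e'. length w = k * nat \<bar>m - n\<bar> \<and> run k (canon L e' n) w = canon L e m"
proof (cases "m \<ge> n")
  case True
  obtain w where w: "length w = k * nat (m - n)"
    "run k (canon L (sig k (m - n) e) n) w = canon L (sig k (m - n) (sig k (m - n) e)) m"
    using run_Delta_power[OF assms, of "nat (m - n)" "sig k (m - n) e" n] True by auto
  moreover have "sig k (m - n) (sig k (m - n) e) = e" by (simp add: sig_def)
  ultimately show ?thesis using True by (intro exI[of _ w] exI[of _ "sig k (m - n) e"]) auto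
next
  case False
  then obtain w where w: "length w = k * nat (n - m)"
    "run k (canon L e m) w = canon L (sig k (n - m) e) n"
    using run_Delta_power[OF assms, of "nat (n - m)" e m] by auto
  show ?thesis
    using run_inverse[OF valid_canon[OF assms], of e m w] w False
    by (intro exI[of _ "rev (map (\<lambda>(c, b). (c, \<not> b)) w)"] exI) auto
qed

text \<open>A cheapest word for the factors reaches an exponent close to the negated sum of
  \<open>half\<close>, and powers of \<open>\<Delta>\<close> correct the rest.\<close>

lemma S_length_le_fold_length:
  assumes "run k start u = (L, e, m)"
  shows "real (S_length k (cls u))
    \<le> real (fold_length k L) + real k * (\<bar>real_of_int m + sum_list (map (half k) L)\<bar> + 1)"
proof -
  have "valid k (L, e, m)" using valid_run[OF k2 valid_start] assms by metis
  then have L: "set L \<subseteq> {1..<k}" and s: "(L, e, m) = canon L e m"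
    by (simp_all add: valid_def)
  obtain n where n: "\<bar>real_of_int n + sum_list (map (half k) L)\<bar> \<le> 1 / 2"
    and reach: "\<And>e. \<exists>v. run k start v = canon L e n \<and> length v \<le> fold_length k L"
    using reach_canon[OF L] by blast
  obtain w e' where w: "length w = k * nat \<bar>m - n\<bar>" "run k (canon L e' n) w = canon L e m"
    using run_Delta_shift[OF L] by blast
  obtain v where v: "run k start v = canon L e' n" "length v \<le> fold_length k L"
    using reach by blast
  have "cls (v @ w) = cls u"
    using v w assms s by (simp add: run_start_eq_iff[symmetric] run_append)
  then have "S_length k (cls u) \<le> fold_length k L + k * nat \<bar>m - n\<bar>"
    using S_length_le[of "v @ w" u] v w by simp
  then have "real (S_length k (cls u)) \<le> real (fold_length k L + k * nat \<bar>m - n\<bar>)"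
    by (rule of_nat_mono)
  also have "\<dots> = real (fold_length k L) + real k * \<bar>real_of_int (m - n)\<bar>" by simp
  also have "\<dots> \<le> real (fold_length k L)
      + real k * (\<bar>real_of_int m + sum_list (map (half k) L)\<bar> + 1)"
  proof (intro add_left_mono mult_left_mono)
    show "\<bar>real_of_int (m - n)\<bar> \<le> \<bar>real_of_int m + sum_list (map (half k) L)\<bar> + 1"
      using n unfolding of_int_diff by linarith
  qed simp
  finally show ?thesis .
qed

end

section \<open>A strong law for functions of uniform random words\<close>

text \<open>Lets centred increments contribute only second order terms to exponential
  moments.\<close>

lemma exp_le_quadratic:
  assumes "\<bar>y\<bar> \<le> (1::real)"
  shows "exp y \<le> 1 + y + y\<^sup>2"
proof (cases "y \<ge> 0")
  case True
  then show ?thesis using exp_bound[of y] assms by simp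
next
  case False
  define z where "z = - y"
  have z: "z \<ge> 0" using False by (simp add: z_def)
  have "exp y * exp z = 1" by (simp add: z_def exp_minus_inverse)
  \<comment> \<open>The claim is \<open>1 \<le> (1 - z + z^2) * exp z\<close>; here
    \<open>exp z\<close> is replaced by its quadratic Taylor polynomial, a lower bound for
    \<open>z \<ge> 0\<close>.\<close>
  also have "1 \<le> (1 - z + z\<^sup>2) * (1 + z + z\<^sup>2 / 2)"
  proof -
    have "(1 - z + z\<^sup>2) * (1 + z + z\<^sup>2 / 2) = 1 + (z\<^sup>2 + z ^ 3 + z ^ 4) / 2"
      by (simp add: field_simps power2_eq_square power3_eq_cube power4_eq_xxxx)
    then show ?thesis using z by simp
  qed
  also have "\<dots> \<le> (1 - z + z\<^sup>2) * exp z"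
  proof (intro mult_left_mono exp_lower_Taylor_quadratic z)
    have "(1 - z + z\<^sup>2) = (1 / 2 - z)\<^sup>2 + 3 / 4" by (simp add: power2_eq_square algebra_simps)
    then show "0 \<le> 1 - z + z\<^sup>2" by simp
  qed
  finally show ?thesis by (simp add: z_def)
qed

section \<open>Exponential moments as sums over words\<close>

lemma lists_length_Suc: "{v. length v = Suc n} = (\<lambda>(v, l). v @ [l]) ` ({v. length v = n} \<times> UNIV)"
proof -
  have "v \<in> (\<lambda>(v, l). v @ [l]) ` ({v. length v = n} \<times> UNIV)" if "length v = Suc n" for v :: "'a list"
    using that by (cases v rule: rev_cases) (auto intro!: rev_image_eqI)
  then show ?thesis by auto
qed

lemma sum_lists_length_Suc:
  fixes f :: "'l::finite list \<Rightarrow> real"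
  shows "(\<Sum>v | length v = Suc n. f v) = (\<Sum>v | length v = n. \<Sum>l\<in>UNIV. f (v @ [l]))"
proof -
  have "inj_on (\<lambda>(v, l). v @ [l]) ({v. length v = n} \<times> (UNIV :: 'l set))"
    by (auto simp: inj_on_def)
  then have "(\<Sum>v | length v = Suc n. f v) = (\<Sum>p\<in>{v. length v = n} \<times> UNIV. f (fst p @ [snd p]))"
    unfolding lists_length_Suc by (subst sum.reindex) (auto simp: case_prod_beta)
  then show ?thesis by (simp add: sum.cartesian_product case_prod_beta)
qed

lemma finite_lists_length [simp]: "finite {v :: 'l::finite list. length v = n}"
  using finite_lists_length_eq[of "UNIV :: 'l set" n] by simp

text \<open>The sum over the words of length \<open>n\<close> is \<open>CARD('l) ^ n\<close> times an expectation for
  independent uniform letters, for which \<open>f\<close> is a martingale.\<close>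

lemma exp_moment_bound:
  fixes f :: "'l::finite list \<Rightarrow> real"
  assumes f0: "f [] = 0"
    and mart: "\<And>v. (\<Sum>l\<in>UNIV. f (v @ [l]) - f v) = 0"
    and bd: "\<And>v l. \<bar>f (v @ [l]) - f v\<bar> \<le> C"
    and t: "0 \<le> t" "t * C \<le> 1"
  shows "(\<Sum>v | length v = n. exp (t * f v)) \<le> (real CARD('l) * exp ((t * C)\<^sup>2)) ^ n"
proof (induction n)
  case 0
  then show ?case by (simp add: f0)
next
  case (Suc n)
  let ?N = "real CARD('l)"
  have "(\<Sum>l\<in>UNIV. exp (t * f (v @ [l]))) \<le> exp (t * f v) * (?N * exp ((t * C)\<^sup>2))" for v
  proof -
    let ?d = "\<lambda>l. t * (f (v @ [l]) - f v)"
    have d: "\<bar>?d l\<bar> \<le> t * C" for l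
      using bd[of v l] t by (simp add: abs_mult mult_left_mono)
    have "(\<Sum>l\<in>UNIV. exp (?d l)) \<le> (\<Sum>l\<in>UNIV. 1 + ?d l + (t * C)\<^sup>2)"
    proof (rule sum_mono)
      fix l :: 'l
      have "(?d l)\<^sup>2 \<le> (t * C)\<^sup>2" using d[of l] by (metis abs_ge_zero power2_abs power_mono)
      then show "exp (?d l) \<le> 1 + ?d l + (t * C)\<^sup>2"
        using exp_le_quadratic[of "?d l"] d[of l] t by linarith
    qed
    \<comment> \<open>The first order terms are collected so that the martingale property removes
      them.\<close>
    also have "\<dots> = ?N * (1 + (t * C)\<^sup>2) + t * (\<Sum>l\<in>UNIV. f (v @ [l]) - f v)"
      unfolding sum.distrib sum_distrib_left[symmetric] by (simp add: algebra_simps)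
    also have "\<dots> = ?N * (1 + (t * C)\<^sup>2)" using mart[of v] by simp
    also have "\<dots> \<le> ?N * exp ((t * C)\<^sup>2)"
      by (intro mult_left_mono exp_ge_add_one_self) auto
    finally have "exp (t * f v) * (\<Sum>l\<in>UNIV. exp (?d l)) \<le> exp (t * f v) * (?N * exp ((t * C)\<^sup>2))"
      by (intro mult_left_mono) auto
    also have "exp (t * f v) * (\<Sum>l\<in>UNIV. exp (?d l)) = (\<Sum>l\<in>UNIV. exp (t * f (v @ [l])))"
      by (simp add: sum_distrib_left exp_add[symmetric] algebra_simps)
    finally show ?thesis .
  qed
  then have "(\<Sum>v | length v = Suc n. exp (t * f v))
      \<le> (\<Sum>v | length v = n. exp (t * f v) * (?N * exp ((t * C)\<^sup>2)))"
    unfolding sum_lists_length_Suc by (intro sum_mono)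
  also have "\<dots> = (\<Sum>v | length v = n. exp (t * f v)) * (?N * exp ((t * C)\<^sup>2))"
    by (simp add: sum_distrib_right)
  also have "\<dots> \<le> (?N * exp ((t * C)\<^sup>2)) ^ n * (?N * exp ((t * C)\<^sup>2))"
    by (intro mult_right_mono Suc) auto
  finally show ?case by (simp add: mult.commute)
qed

section \<open>Random words with independent uniform letters\<close>

locale uniform_letters = prob_space M
  for M :: "'w measure" and Y :: "nat \<Rightarrow> 'w \<Rightarrow> 'l::finite" +
  assumes indep: "indep_vars (\<lambda>_. count_space UNIV) Y {1..}"
    and uniform: "\<And>i l. i \<ge> 1 \<Longrightarrow> prob (Y i -` {l} \<inter> space M) = 1 / real CARD('l)"
begin

definition hist :: "nat \<Rightarrow> 'w \<Rightarrow> 'l list" where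
  "hist n \<omega> = map (\<lambda>i. Y i \<omega>) [1..<Suc n]"

lemma hist_0 [simp]: "hist 0 \<omega> = []"
  and length_hist [simp]: "length (hist n \<omega>) = n"
  by (simp_all add: hist_def)

lemma take_hist: "j \<le> n \<Longrightarrow> take j (hist n \<omega>) = hist j \<omega>"
  by (simp add: hist_def take_map take_upt del: upt_Suc)

lemma hist_eq_iff: "length v = n \<Longrightarrow> hist n \<omega> = v \<longleftrightarrow> (\<forall>i\<in>{1..n}. Y i \<omega> = v ! (i - 1))"
proof -
  assume v: "length v = n"
  have "{1..n} = Suc ` {..<n}" by (simp add: image_Suc_lessThan)
  then show ?thesis using v
    by (auto simp: list_eq_iff_nth_eq hist_def simp del: upt_Suc)
qed

lemma measurable_Y: "i \<ge> 1 \<Longrightarrow> Y i \<in> measurable M (count_space UNIV)"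
  using indep by (auto simp: indep_vars_def)

lemma hist_event:
  assumes "length v = n"
  shows "{\<omega>\<in>space M. hist n \<omega> = v} \<in> events" "prob {\<omega>\<in>space M. hist n \<omega> = v} = (1 / real CARD('l)) ^ n"
proof -
  let ?E = "\<lambda>i. Y i -` {v ! (i - 1)} \<inter> space M"
  have ev: "?E i \<in> events" if "i \<ge> 1" for i
    using measurable_sets[OF measurable_Y[OF that]] by simp
  show "{\<omega>\<in>space M. hist n \<omega> = v} \<in> events"
    "prob {\<omega>\<in>space M. hist n \<omega> = v} = (1 / real CARD('l)) ^ n"
  proof (atomize (full), cases "n = 0")
    case True
    then show "{\<omega>\<in>space M. hist n \<omega> = v} \<in> events \<and>
        prob {\<omega>\<in>space M. hist n \<omega> = v} = (1 / real CARD('l)) ^ n"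
      using assms by (simp add: prob_space)
  next
    case False
    then have eq: "{\<omega>\<in>space M. hist n \<omega> = v} = (\<Inter>i\<in>{1..n}. ?E i)"
      by (auto simp: hist_eq_iff[OF assms])
    have "prob (\<Inter>i\<in>{1..n}. ?E i) = (\<Prod>i\<in>{1..n}. prob (?E i))"
      by (rule indep_varsD[OF indep]) (use False in auto)
    also have "\<dots> = (\<Prod>i\<in>{1..n}. 1 / real CARD('l))"
      by (intro prod.cong) (auto simp: uniform)
    finally have "prob (\<Inter>i\<in>{1..n}. ?E i) = (1 / real CARD('l)) ^ n" by simp
    moreover have "(\<Inter>i\<in>{1..n}. ?E i) \<in> events"
      by (rule sets.finite_INT) (use False ev in auto)
    ultimately show "{\<omega>\<in>space M. hist n \<omega> = v} \<in> events \<and>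
        prob {\<omega>\<in>space M. hist n \<omega> = v} = (1 / real CARD('l)) ^ n"
      unfolding eq by blast
  qed
qed

text \<open>Events in the first \<open>n\<close> letters become counts of words, so the moment bound
  can be used without conditional expectations.\<close>

lemma hist_in:
  "{\<omega>\<in>space M. hist n \<omega> \<in> A} \<in> events"
  "prob {\<omega>\<in>space M. hist n \<omega> \<in> A} = real (card {v\<in>A. length v = n}) / real CARD('l) ^ n"
proof -
  let ?B = "{v\<in>A. length v = n}"
  have fin: "finite ?B" by (rule finite_subset[OF _ finite_lists_length[of n]]) auto
  have eq: "{\<omega>\<in>space M. hist n \<omega> \<in> A} = (\<Union>v\<in>?B. {\<omega>\<in>space M. hist n \<omega> = v})"
    by auto
  show "{\<omega>\<in>space M. hist n \<omega> \<in> A} \<in> events"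
    unfolding eq using fin hist_event(1) by (intro sets.finite_UN) auto
  have "prob (\<Union>v\<in>?B. {\<omega>\<in>space M. hist n \<omega> = v}) = (\<Sum>v\<in>?B. prob {\<omega>\<in>space M. hist n \<omega> = v})"
    using fin hist_event(1) by (intro finite_measure_finite_Union) (auto simp: disjoint_family_on_def)
  also have "\<dots> = (\<Sum>v\<in>?B. (1 / real CARD('l)) ^ n)"
    by (intro sum.cong hist_event(2)) auto
  finally show "prob {\<omega>\<in>space M. hist n \<omega> \<in> A} = real (card ?B) / real CARD('l) ^ n"
    unfolding eq by (simp add: power_divide)
qed

text \<open>The exponential Markov inequality makes the exceptional probabilities decay
  geometrically, and the Borel-Cantelli lemma applies.\<close>

lemma martingale_eventually_less:
  fixes f :: "'l list \<Rightarrow> real"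
  assumes f0: "f [] = 0"
    and mart: "\<And>v. (\<Sum>l\<in>UNIV. f (v @ [l]) - f v) = 0"
    and bd: "\<And>v l. \<bar>f (v @ [l]) - f v\<bar> \<le> C"
    and "\<epsilon> > 0"
  shows "AE \<omega> in M. eventually (\<lambda>n. f (hist n \<omega>) < \<epsilon> * real n) sequentially"
proof -
  \<comment> \<open>Enlarging the bound beyond \<open>\<epsilon>\<close> guarantees
    \<open>t * D \<le> 1\<close> for the \<open>t\<close> below.\<close>
  define D where "D = max C (max 1 \<epsilon>)"
  have D: "\<And>v l. \<bar>f (v @ [l]) - f v\<bar> \<le> D" "D \<ge> 1" "D \<ge> \<epsilon>"
    using order_trans[OF bd max.cobounded1] by (auto simp: D_def)
  \<comment> \<open>This minimises the exponent \<open>(t * D)^2 - t * \<epsilon>\<close>.\<close>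
  define t where "t = \<epsilon> / (2 * D\<^sup>2)"
  have t: "0 < t" using D \<open>\<epsilon> > 0\<close> by (simp add: t_def)
  have "t * D = \<epsilon> / (2 * D)" using D by (simp add: t_def power2_eq_square)
  also have "\<dots> \<le> 1" using D by simp
  finally have tD: "t * D \<le> 1" .
  define r where "r = exp (- (\<epsilon>\<^sup>2 / (4 * D\<^sup>2)))"
  have tt: "(t * D)\<^sup>2 - t * \<epsilon> = - (\<epsilon>\<^sup>2 / (4 * D\<^sup>2))"
    using D by (simp add: t_def field_simps power2_eq_square)
  let ?N = "real CARD('l)"
  let ?A = "\<lambda>n. {\<omega>\<in>space M. hist n \<omega> \<in> {v. \<epsilon> * real n \<le> f v}}"
  have prob: "prob (?A n) \<le> r ^ n" for n
  proof -
    let ?B = "{v\<in>{v. \<epsilon> * real n \<le> f v}. length v = n}"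
    have "real (card ?B) * exp (t * (\<epsilon> * real n)) = (\<Sum>v\<in>?B. exp (t * (\<epsilon> * real n)))" by simp
    also have "\<dots> \<le> (\<Sum>v\<in>?B. exp (t * f v))"
      using t by (intro sum_mono) (auto intro: mult_left_mono)
    also have "\<dots> \<le> (\<Sum>v | length v = n. exp (t * f v))"
      by (intro sum_mono2) auto
    also have "\<dots> \<le> (?N * exp ((t * D)\<^sup>2)) ^ n"
      using exp_moment_bound[of f D t n] f0 mart D t tD by simp
    finally have "real (card ?B) \<le> (?N * exp ((t * D)\<^sup>2)) ^ n / exp (t * (\<epsilon> * real n))"
      by (simp add: pos_le_divide_eq)
    also have "\<dots> = ?N ^ n * (exp ((t * D)\<^sup>2) ^ n / exp (t * \<epsilon>) ^ n)"
      by (simp add: power_mult_distrib exp_of_nat_mult[symmetric] algebra_simps)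
    also have "exp ((t * D)\<^sup>2) ^ n / exp (t * \<epsilon>) ^ n = r ^ n"
      unfolding power_divide[symmetric] exp_diff[symmetric] tt r_def ..
    finally show ?thesis unfolding hist_in(2) by (simp add: pos_divide_le_eq mult.commute)
  qed
  have "r < 1" using D \<open>\<epsilon> > 0\<close> by (simp add: r_def)
  then have "summable (\<lambda>n. r ^ n)" by (intro summable_geometric) (simp add: r_def)
  then have "summable (\<lambda>n. prob (?A n))"
    by (rule summable_comparison_test_ev[rotated]) (use prob in \<open>auto intro!: always_eventually\<close>)
  then have "AE \<omega> in M. eventually (\<lambda>n. \<omega> \<in> space M - ?A n) sequentially"
    by (intro borel_cantelli_AE1) (simp_all add: hist_in(1) emeasure_eq_measure del: mem_Collect_eq)
  then show ?thesis
    by (rule AE_mp) (auto intro!: AE_I2 elim!: eventually_mono)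
qed

lemma martingale_slln:
  fixes f :: "'l list \<Rightarrow> real"
  assumes f0: "f [] = 0"
    and mart: "\<And>v. (\<Sum>l\<in>UNIV. f (v @ [l]) - f v) = 0"
    and bd: "\<And>v l. \<bar>f (v @ [l]) - f v\<bar> \<le> C"
  shows "AE \<omega> in M. (\<lambda>n. f (hist n \<omega>) / real n) \<longlonglongrightarrow> 0"
proof -
  have neg: "(\<Sum>l\<in>UNIV. - f (v @ [l]) - - f v) = 0" for v
    using mart[of v] by (simp add: sum_subtractf sum_negf)
  have "AE \<omega> in M. \<forall>j::nat. eventually (\<lambda>n. f (hist n \<omega>) < 1 / real (Suc j) * real n) sequentially \<and>
      eventually (\<lambda>n. - f (hist n \<omega>) < 1 / real (Suc j) * real n) sequentially"
    unfolding AE_all_countable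
  proof (intro allI AE_conjI)
    fix j :: nat
    show "AE \<omega> in M. eventually (\<lambda>n. f (hist n \<omega>) < 1 / real (Suc j) * real n) sequentially"
      by (rule martingale_eventually_less[OF f0 mart bd]) simp
    show "AE \<omega> in M. eventually (\<lambda>n. - f (hist n \<omega>) < 1 / real (Suc j) * real n) sequentially"
      by (rule martingale_eventually_less[of "\<lambda>v. - f v" C]) (use f0 neg bd in \<open>auto simp: abs_minus_commute\<close>)
  qed
  then show ?thesis
  proof (rule AE_mp, intro AE_I2 impI)
    fix \<omega>
    assume *: "\<forall>j::nat. eventually (\<lambda>n. f (hist n \<omega>) < 1 / real (Suc j) * real n) sequentially \<and>
      eventually (\<lambda>n. - f (hist n \<omega>) < 1 / real (Suc j) * real n) sequentially"
    show "(\<lambda>n. f (hist n \<omega>) / real n) \<longlonglongrightarrow> 0"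
    proof (rule tendstoI)
      fix e :: real assume "e > 0"
      then obtain j where j: "1 / real (Suc j) < e" using nat_approx_posE by blast
      have "eventually (\<lambda>n. n > 0 \<and> f (hist n \<omega>) < 1 / real (Suc j) * real n \<and>
          - f (hist n \<omega>) < 1 / real (Suc j) * real n) sequentially"
        using * by (intro eventually_conj eventually_gt_at_top) auto
      then show "eventually (\<lambda>n. dist (f (hist n \<omega>) / real n) 0 < e) sequentially"
      proof (rule eventually_mono)
        fix n assume n: "n > 0 \<and> f (hist n \<omega>) < 1 / real (Suc j) * real n \<and>
          - f (hist n \<omega>) < 1 / real (Suc j) * real n"
        then have "\<bar>f (hist n \<omega>)\<bar> < 1 / real (Suc j) * real n" by linarith
        then have "\<bar>f (hist n \<omega>)\<bar> / real n < 1 / real (Suc j)"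
          using n by (simp add: pos_divide_less_eq)
        then show "dist (f (hist n \<omega>) / real n) 0 < e" using j by simp
      qed
    qed
  qed
qed

definition drift :: "('l list \<Rightarrow> real) \<Rightarrow> 'l list \<Rightarrow> real" where
  "drift f v = (\<Sum>l\<in>UNIV. f (v @ [l]) - f v) / real CARD('l)"

text \<open>Doob decomposition: subtracting the sum of the mean increments along the prefixes leaves
  a martingale whose increments are at most \<open>2 * C\<close>.\<close>

lemma additive_functional_slln:
  fixes f :: "'l list \<Rightarrow> real"
  assumes bd: "\<And>v l. \<bar>f (v @ [l]) - f v\<bar> \<le> C"
  shows "AE \<omega> in M. (\<lambda>n. (f (hist n \<omega>) - (\<Sum>j<n. drift f (hist j \<omega>))) / real n) \<longlonglongrightarrow> 0"
proof -
  define g where "g v = f v - f [] - (\<Sum>j<length v. drift f (take j v))" for v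
  have step: "g (v @ [l]) - g v = f (v @ [l]) - f v - drift f v" for v l
  proof -
    have "(\<Sum>j<length v. drift f (take j (v @ [l]))) = (\<Sum>j<length v. drift f (take j v))"
      by (intro sum.cong) auto
    then show ?thesis by (simp add: g_def)
  qed
  have "\<bar>drift f v\<bar> \<le> C" for v
  proof -
    have "\<bar>\<Sum>l\<in>UNIV. f (v @ [l]) - f v\<bar> \<le> (\<Sum>l\<in>(UNIV :: 'l set). C)"
      using bd by (intro order_trans[OF sum_abs] sum_mono)
    then show ?thesis by (simp add: drift_def abs_divide pos_divide_le_eq mult.commute)
  qed
  then have "\<bar>g (v @ [l]) - g v\<bar> \<le> 2 * C" for v l
    unfolding step using bd[of v l] by (smt (verit))
  moreover have "(\<Sum>l\<in>UNIV. g (v @ [l]) - g v) = 0" for v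
    unfolding step by (simp add: sum_subtractf drift_def)
  ultimately have "AE \<omega> in M. (\<lambda>n. g (hist n \<omega>) / real n) \<longlonglongrightarrow> 0"
    by (intro martingale_slln) (simp_all add: g_def)
  then show ?thesis
  proof (rule AE_mp, intro AE_I2 impI)
    fix \<omega> assume "(\<lambda>n. g (hist n \<omega>) / real n) \<longlonglongrightarrow> 0"
    moreover have "(\<lambda>n. f [] / real n) \<longlonglongrightarrow> 0"
      by (rule lim_const_over_n)
    ultimately have "(\<lambda>n. g (hist n \<omega>) / real n + f [] / real n) \<longlonglongrightarrow> 0"
      by (intro tendsto_add_zero)
    moreover have "(\<Sum>j<n. drift f (take j (hist n \<omega>))) = (\<Sum>j<n. drift f (hist j \<omega>))" for n
      by (intro sum.cong) (auto simp: take_hist)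
    ultimately show "(\<lambda>n. (f (hist n \<omega>) - (\<Sum>j<n. drift f (hist j \<omega>))) / real n) \<longlonglongrightarrow> 0"
      by (simp add: g_def diff_divide_distrib)
  qed
qed

end

section \<open>Additive functionals of the normal form\<close>

lemma UNIV_gen: "UNIV = {ga, gb}"
  by (auto intro: gen.exhaust)

instance gen :: finite
  by standard (simp add: UNIV_gen)

lemma card_gen [simp]: "CARD(gen) = 2"
  by (simp add: UNIV_gen)

lemma UNIV_letters: "(UNIV :: (gen \<times> bool) set) = {(e, True), (other e, True), (e, False), (other e, False)}"
  by (cases e) (auto intro: gen.exhaust)

lemma sum_letters:
  "(\<Sum>l\<in>UNIV. f l) = f (e, True) + f (other e, True) + f (e, False) + (f (other e, False) :: real)"
  unfolding UNIV_letters[of e] by simp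

text \<open>
  If a letter of length \<open>i\<close> is erased with probability \<open>q i\<close>, then \<open>corr v q\<close> sums, over all
  levels of the stack, \<open>v\<close> at that level times the probability that everything above is erased.
\<close>

fun corr :: "(nat \<Rightarrow> real) \<Rightarrow> (nat \<Rightarrow> real) \<Rightarrow> nat list \<Rightarrow> real" where
  "corr v q [] = 0"
| "corr v q (i # L) = v i + q i * corr v q L"

text \<open>Later \<open>v = h - w\<close>, where \<open>w\<close> solves a Dirichlet problem; this
  choice makes the mean increment constant on nonempty stacks.\<close>

definition potential :: "(nat \<Rightarrow> real) \<Rightarrow> (nat \<Rightarrow> real) \<Rightarrow> (nat \<Rightarrow> real) \<Rightarrow> nat list \<Rightarrow> real" where
  "potential h v q L = sum_list (map h L) - corr v q L"

lemma corr_bounded: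
  assumes "finite A" and q: "\<And>i. i \<in> A \<Longrightarrow> 0 \<le> q i \<and> q i < 1"
  obtains K where "\<And>L. set L \<subseteq> A \<Longrightarrow> \<bar>corr v q L\<bar> \<le> K"
proof -
  \<comment> \<open>Bounds all the ratios, so the correction is dominated by a geometric series; the
    inserted 0 covers empty \<open>A\<close>.\<close>
  define r where "r = Max (insert 0 (q ` A))"
  have r: "\<And>i. i \<in> A \<Longrightarrow> q i \<le> r" "0 \<le> r"
    using \<open>finite A\<close> by (auto simp: r_def)
  have "r \<in> insert 0 (q ` A)"
    unfolding r_def using \<open>finite A\<close> by (intro Max_in) auto
  then have "r < 1" using q by auto
  define B where "B = (\<Sum>i\<in>A. \<bar>v i\<bar>)"
  have B: "\<bar>v i\<bar> \<le> B" if "i \<in> A" for i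
    unfolding B_def using \<open>finite A\<close> that by (intro member_le_sum) auto
  have "B \<ge> 0" unfolding B_def by (intro sum_nonneg) auto
  have "\<bar>corr v q L\<bar> \<le> B / (1 - r)" if "set L \<subseteq> A" for L
    using that
  proof (induction L)
    case Nil
    then show ?case using \<open>B \<ge> 0\<close> \<open>r < 1\<close> by simp
  next
    case (Cons i L)
    have "\<bar>corr v q (i # L)\<bar> \<le> \<bar>v i\<bar> + q i * \<bar>corr v q L\<bar>"
      using q[of i] Cons.prems abs_triangle_ineq[of "v i" "q i * corr v q L"] by (simp add: abs_mult)
    also have "\<dots> \<le> B + r * (B / (1 - r))"
      using Cons B[of i] r q[of i] by (intro add_mono mult_mono) auto
    also have "\<dots> = B / (1 - r)" using \<open>r < 1\<close> by (simp add: field_simps)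
    finally show ?case .
  qed
  then show thesis by (rule that)
qed

section \<open>The correction with constant mean increment\<close>

context F_root
begin

text \<open>On a nonempty stack the moves produce the recurrence of \<open>q\<close> as the
  coefficient of everything below the top factor, which vanishes, and the recurrence of
  \<open>w\<close>, which cancels \<open>h i\<close>. Only the values of \<open>w\<close> next to
  the boundary remain. On the empty stack all four letters append a factor, which doubles
  them.\<close>

lemma sum_act_potential:
  assumes h: "h 0 = 0" "h k = 0" and w: "w 0 = 0" "w k = 0"
    and rec: "\<And>i. 0 < i \<Longrightarrow> w (i + 1) + w (i - 1) - 2 * (2 - x) * w i = - (2 * (1 - x) * h i)"
    and s: "valid k s"
  shows "(\<Sum>l\<in>UNIV. potential h (\<lambda>i. h i - w i) q (fst (act k s l)) - potential h (\<lambda>i. h i - w i) q (fst s))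
    = (if fst s = [] then 2 else 1) * (w 1 + w (k - 1))"
proof -
  let ?P = "potential h (\<lambda>i. h i - w i) q"
  show ?thesis using s
  proof (cases rule: valid_cases)
    case (1 m)
    then show ?thesis unfolding sum_letters[of _ ga] by (simp add: potential_def)
  next
    case (2 i L e m)
    define S V where "S = sum_list (map h L)" and "V = corr (\<lambda>i. h i - w i) q L"
    have top: "?P (j # L) = w j + S - q j * V" for j
      by (simp add: potential_def S_def V_def)
    have push: "?P (j # i # L) = w j + h i + S - q j * (h i - w i + q i * V)" for j
      by (simp add: potential_def S_def V_def)
    \<comment> \<open>At lengths 0 and \<open>k\<close> the top factor is gone; there
      \<open>w\<close> is 0 and \<open>q\<close> is 1, so the formula \<open>top\<close> also covers
      erasure.\<close>
    have bot: "?P L = w 0 + S - q 0 * V" "?P L = w k + S - q k * V"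
      using w root by (simp_all add: potential_def S_def V_def)
    have act: "?P (fst (act k s (e, True))) = ?P (1 # i # L)"
      "?P (fst (act k s (other e, True))) = w (i + 1) + S - q (i + 1) * V"
      "?P (fst (act k s (e, False))) = w (i - 1) + S - q (i - 1) * V"
      "?P (fst (act k s (other e, False))) = ?P ((k - 1) # i # L)"
    proof -
      show "?P (fst (act k s (other e, True))) = w (i + 1) + S - q (i + 1) * V"
      proof (cases "Suc i < k")
        case False
        then have "k = i + 1" using 2 by simp
        then show ?thesis using 2 bot(2) by simp
      qed (use 2 top in auto)
      show "?P (fst (act k s (e, False))) = w (i - 1) + S - q (i - 1) * V"
      proof (cases "i > 1")
        case False
        then have "i = 1" using 2 by simp
        then show ?thesis using 2 bot(1) by simp
      qed (use 2 top in auto)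
    qed (use 2 in auto)
    have q1: "q 1 = x" "q (k - 1) = x" using q_sym[of 1] k3 by auto
    have "(\<Sum>l\<in>UNIV. ?P (fst (act k s l)) - ?P (fst s))
      = w 1 + w (k - 1) + (w (i + 1) + w (i - 1) - 2 * (2 - x) * w i + 2 * (1 - x) * h i)
        - (q (i + 1) + q (i - 1) - 2 * (2 - x) * q i) * V"
      unfolding sum_letters[of _ e] act push q1 using top[of i] 2 by (simp add: algebra_simps)
    then show ?thesis using rec[of i] poly_F_rec[of i x] 2 by simp
  qed
qed

text \<open>Green's identity against the solution \<open>q\<close> of the homogeneous equation.\<close>

lemma boundary_slope_sum:
  assumes w: "w 0 = 0" "w k = 0"
    and rec: "\<And>i. 0 < i \<Longrightarrow> w (i + 1) + w (i - 1) - 2 * (2 - x) * w i = - (2 * (1 - x) * h i)"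
  shows "w 1 + w (k - 1) = 2 * (1 - x) * (\<Sum>i=1..<k. q i * h i)"
proof -
  \<comment> \<open>The discrete Wronskian of \<open>q\<close> and \<open>w\<close>; its increments
    contain only the inhomogeneous term.\<close>
  let ?G = "\<lambda>i. q i * w (i + 1) - q (i + 1) * w i"
  obtain n where n: "k = Suc n" using k3 by (cases k) auto
  have "- (2 * (1 - x) * (q i * h i)) = ?G i - ?G (i - 1)" if "0 < i" for i
  proof -
    have "- (2 * (1 - x) * (q i * h i)) = q i * (w (i + 1) + w (i - 1) - 2 * (2 - x) * w i)"
      using rec[OF that] by simp
    also have "\<dots> = q i * w (i + 1) + q i * w (i - 1) - (2 * (2 - x) * q i) * w i"
      by (simp add: algebra_simps)
    also have "\<dots> = ?G i - ?G (i - 1)"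
      unfolding poly_F_rec[OF that, symmetric] using that by (simp add: algebra_simps)
    finally show ?thesis .
  qed
  then have "(\<Sum>i=Suc 0..n. - (2 * (1 - x) * (q i * h i))) = (\<Sum>i=Suc 0..n. ?G i - ?G (i - 1))"
    by (intro sum.cong) auto
  also have "\<dots> = ?G n - ?G 0"
    by (subst sum_telescope'') auto
  also have "\<dots> = - (w 1 + w (k - 1))" using w root n by simp
  finally have "(\<Sum>i=Suc 0..n. 2 * (1 - x) * (q i * h i)) = w 1 + w (k - 1)"
    by (simp add: sum_negf)
  moreover have "{1..<k} = {Suc 0..n}" using n by auto
  ultimately show ?thesis by (simp add: sum_distrib_left)
qed

lemma potential_exists:
  assumes h: "h 0 = 0" "h k = 0"
  obtains v where "\<And>s. valid k s \<Longrightarrow>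
    (\<Sum>l\<in>UNIV. potential h v q (fst (act k s l)) - potential h v q (fst s))
      = (if fst s = [] then 2 else 1) * (2 * (1 - x) * (\<Sum>i=1..<k. q i * h i))"
proof -
  obtain w where w: "w 0 = 0" "w k = 0"
    "\<And>i. 0 < i \<Longrightarrow> w (i + 1) + w (i - 1) - 2 * (2 - x) * w i = - (2 * (1 - x) * h i)"
    by (rule discrete_dirichlet_exists[of "2 - x" k "\<lambda>i. 2 * (1 - x) * h i"]) (use x1 k3 in auto)
  show thesis
    by (rule that[of "\<lambda>i. h i - w i"])
      (simp only: sum_act_potential[OF h w] boundary_slope_sum[OF w])
qed

end

lemma sum_list_act_bounded:
  assumes "k \<ge> 2" "valid k s"
  shows "\<bar>sum_list (map h (fst (act k s l))) - sum_list (map h (fst s))\<bar> \<le> 2 * (\<Sum>i\<le>k. \<bar>h i\<bar> :: real)"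
proof -
  let ?B = "\<Sum>i\<le>k. \<bar>h i\<bar>"
  have h: "\<bar>h i\<bar> \<le> ?B" if "i \<le> k" for i using that by (intro member_le_sum) auto
  have B: "0 \<le> ?B" by (intro sum_nonneg) auto
  have diff: "\<bar>h i - h j\<bar> \<le> 2 * ?B" if "i \<le> k" "j \<le> k" for i j
    using h[OF that(1)] h[OF that(2)] by linarith
  have h2: "\<bar>h i\<bar> \<le> 2 * ?B" if "i \<le> k" for i using h[OF that] B by linarith
  obtain c b where l: "l = (c, b)" by force
  show ?thesis using assms(2)
  proof (cases rule: valid_cases)
    case (1 m)
    then show ?thesis using assms(1) h2 by (cases b) (auto simp: l)
  next
    case (2 i L e m)
    then show ?thesis using assms(1) h2 diff B by (cases b) (auto simp: l)
  qed
qed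

lemma cesaro_eventually_const:
  fixes d :: "nat \<Rightarrow> real"
  assumes "eventually (\<lambda>n. d n = c) sequentially"
  shows "(\<lambda>n. (\<Sum>j<n. d j) / real n) \<longlonglongrightarrow> c"
proof -
  obtain N where N: "\<And>n. n \<ge> N \<Longrightarrow> d n = c" using assms by (auto simp: eventually_sequentially)
  have "(\<lambda>n. c + (\<Sum>j<N. d j - c) / real n) \<longlonglongrightarrow> c + 0"
    by (intro tendsto_add tendsto_const lim_const_over_n)
  moreover have "eventually (\<lambda>n. c + (\<Sum>j<N. d j - c) / real n = (\<Sum>j<n. d j) / real n) sequentially"
    using eventually_ge_at_top[of "Suc N"]
  proof eventually_elim
    case (elim n)
    have "(\<Sum>j<n. d j - c) = (\<Sum>j<N. d j - c)"
      by (rule sum.mono_neutral_right) (use elim N in auto)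
    moreover have "(\<Sum>j<n. d j) = (\<Sum>j<n. d j - c) + real n * c"
      by (simp add: sum_subtractf)
    ultimately show ?case using elim by (simp add: field_simps)
  qed
  ultimately show ?thesis by (simp add: filterlim_cong)
qed

section \<open>Laws of large numbers for the states of the walk\<close>

locale letter_walk = F_root k x + uniform_letters M Y
  for k x and M :: "'w measure" and Y :: "nat \<Rightarrow> 'w \<Rightarrow> gen \<times> bool"
begin

definition st :: "nat \<Rightarrow> 'w \<Rightarrow> state" where
  "st n \<omega> = run k start (hist n \<omega>)"

text \<open>One quarter of the sum over the four letters in \<open>potential_exists\<close>, hence
  the mean increment per step on a nonempty stack.\<close>

definition freq :: "(nat \<Rightarrow> real) \<Rightarrow> real" where
  "freq h = (1 - x) / 2 * (\<Sum>i=1..<k. q i * h i)"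

lemma k2': "k \<ge> 2"
  using k3 by simp

lemma valid_run_start: "valid k (run k start v)"
  by (rule valid_run[OF k2' valid_start])

lemma valid_st: "valid k (st n \<omega>)"
  by (simp add: st_def valid_run_start)

lemma st_subset: "set (fst (st n \<omega>)) \<subseteq> {1..<k}"
  using valid_st by (simp add: valid_def)

lemma potential_slln:
  assumes h: "h 0 = 0" "h k = 0"
  obtains v where "AE \<omega> in M. (\<lambda>n. (potential h v q (fst (st n \<omega>))
      - (\<Sum>j<n. (if fst (st j \<omega>) = [] then 2 else 1) * freq h)) / real n) \<longlonglongrightarrow> 0"
proof -
  obtain v where v: "\<And>s. valid k s \<Longrightarrow>
    (\<Sum>l\<in>UNIV. potential h v q (fst (act k s l)) - potential h v q (fst s))
      = (if fst s = [] then 2 else 1) * (2 * (1 - x) * (\<Sum>i=1..<k. q i * h i))"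
    using potential_exists[OF h] by blast
  obtain K where K: "\<And>L. set L \<subseteq> {1..<k} \<Longrightarrow> \<bar>corr v q L\<bar> \<le> K"
    by (rule corr_bounded[of "{1..<k}" q v]) (auto simp: q_nonneg q_less_1)
  define f where "f u = potential h v q (fst (run k start u))" for u
  have "\<bar>f (u @ [l]) - f u\<bar> \<le> 2 * (\<Sum>i\<le>k. \<bar>h i\<bar>) + 2 * K" for u l
  proof -
    let ?s = "run k start u"
    have "\<bar>corr v q (fst (act k ?s l))\<bar> \<le> K" "\<bar>corr v q (fst ?s)\<bar> \<le> K"
      using K valid_run_start[of u] valid_act[OF k2' valid_run_start] by (auto simp: valid_def)
    then show ?thesis
      using sum_list_act_bounded[OF k2' valid_run_start, of h u l]
      by (simp add: f_def potential_def run_append)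
  qed
  moreover have "drift f u = (if fst (run k start u) = [] then 2 else 1) * freq h" for u
    unfolding drift_def f_def using v[OF valid_run_start, of u]
    by (simp add: run_append freq_def)
  ultimately have "AE \<omega> in M. (\<lambda>n. (f (hist n \<omega>)
      - (\<Sum>j<n. (if fst (run k start (hist j \<omega>)) = [] then 2 else 1) * freq h)) / real n) \<longlonglongrightarrow> 0"
    using additive_functional_slln[of f "2 * (\<Sum>i\<le>k. \<bar>h i\<bar>) + 2 * K"] by simp
  then show thesis by (intro that[of v]) (simp add: st_def f_def)
qed

text \<open>With \<open>h\<close> counting factors, the accumulated mean increments grow at least
  linearly, whereas the potential of the empty stack is 0. Infinitely many returns to the empty
  stack would contradict the strong law.\<close>

lemma transient: "AE \<omega> in M. eventually (\<lambda>n. fst (st n \<omega>) \<noteq> []) sequentially"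
proof -
  define h where "h i = (if 0 < i \<and> i < k then 1 else 0 :: real)" for i
  have "freq h = (1 - x) / 2"
    using q_sum by (simp add: freq_def h_def)
  then have pos: "freq h > 0" using x1 by simp
  have "h 0 = 0" "h k = 0" by (simp_all add: h_def)
  from potential_slln[OF this] obtain v where
    "AE \<omega> in M. (\<lambda>n. (potential h v q (fst (st n \<omega>))
      - (\<Sum>j<n. (if fst (st j \<omega>) = [] then 2 else 1) * freq h)) / real n) \<longlonglongrightarrow> 0" .
  then show ?thesis
  proof (rule AE_mp, intro AE_I2 impI)
    fix \<omega>
    let ?d = "\<lambda>n. \<Sum>j<n. (if fst (st j \<omega>) = [] then 2 else 1) * freq h"
    assume "(\<lambda>n. (potential h v q (fst (st n \<omega>)) - ?d n) / real n) \<longlonglongrightarrow> 0"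
    then have "eventually (\<lambda>n. (potential h v q (fst (st n \<omega>)) - ?d n) / real n > - freq h) sequentially"
      using pos by (intro order_tendstoD) auto
    then show "eventually (\<lambda>n. fst (st n \<omega>) \<noteq> []) sequentially"
      using eventually_gt_at_top[of 0]
    proof eventually_elim
      case (elim n)
      have "(\<Sum>j<n. freq h) \<le> ?d n" using pos by (intro sum_mono) auto
      then have "real n * freq h \<le> ?d n" by simp
      moreover have "potential h v q (fst (st n \<omega>)) - ?d n > - freq h * real n"
        using elim by (simp add: pos_less_divide_eq)
      ultimately show ?case by (auto simp: potential_def mult.commute)
    qed
  qed
qed

text \<open>By transience the mean increment is eventually \<open>freq h\<close>, and the bounded
  correction disappears after division by \<open>n\<close>.\<close>

lemma additive_lln:
  "AE \<omega> in M. (\<lambda>n. sum_list (map h (fst (st n \<omega>))) / real n) \<longlonglongrightarrow> freq h"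
proof -
  \<comment> \<open>Cutting \<open>h\<close> off outside the possible lengths enforces the boundary
    values 0 and changes neither side.\<close>
  define g where "g i = (if 0 < i \<and> i < k then h i else 0)" for i
  have fg: "freq g = freq h" by (simp add: freq_def g_def)
  have gh: "map g (fst (st n \<omega>)) = map h (fst (st n \<omega>))" for n \<omega>
    using st_subset[of n \<omega>] by (auto simp: g_def)
  have "g 0 = 0" "g k = 0" by (simp_all add: g_def)
  from potential_slln[OF this] obtain v where ae:
    "AE \<omega> in M. (\<lambda>n. (potential g v q (fst (st n \<omega>))
      - (\<Sum>j<n. (if fst (st j \<omega>) = [] then 2 else 1) * freq g)) / real n) \<longlonglongrightarrow> 0" .
  obtain K where K: "\<And>L. set L \<subseteq> {1..<k} \<Longrightarrow> \<bar>corr v q L\<bar> \<le> K"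
    by (rule corr_bounded[of "{1..<k}" q v]) (auto simp: q_nonneg q_less_1)
  show ?thesis using ae transient
  proof eventually_elim
    case (elim \<omega>)
    let ?d = "\<lambda>j. (if fst (st j \<omega>) = [] then 2 else 1) * freq g"
    have "(\<lambda>n. (\<Sum>j<n. ?d j) / real n) \<longlonglongrightarrow> freq g"
      by (rule cesaro_eventually_const) (use elim(2) in \<open>eventually_elim, auto\<close>)
    moreover have "(\<lambda>n. corr v q (fst (st n \<omega>)) / real n) \<longlonglongrightarrow> 0"
    proof (rule Lim_null_comparison)
      show "eventually (\<lambda>n. norm (corr v q (fst (st n \<omega>)) / real n) \<le> K / real n) sequentially"
        using K[OF st_subset] by (intro always_eventually) (auto intro: divide_right_mono)
    qed (rule lim_const_over_n)
    ultimately have "(\<lambda>n. (potential g v q (fst (st n \<omega>)) - (\<Sum>j<n. ?d j)) / real n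
        + (\<Sum>j<n. ?d j) / real n + corr v q (fst (st n \<omega>)) / real n) \<longlonglongrightarrow> 0 + freq g + 0"
      by (intro tendsto_add elim(1))
    then show ?case
      by (simp add: potential_def gh fg diff_divide_distrib)
  qed
qed

text \<open>The quantity is the exponent sum of the element, with \<open>\<Delta>\<close> counted as
  \<open>k\<close> letters; each step changes it by +1 or -1 with equal probability.\<close>

lemma exponent_sum_lln:
  "AE \<omega> in M. (\<lambda>n. (real (sum_list (fst (st n \<omega>))) + real k * real_of_int (snd (snd (st n \<omega>)))) / real n) \<longlonglongrightarrow> 0"
proof -
  define \<phi> where "\<phi> s = real (sum_list (fst s)) + real k * real_of_int (snd (snd s))" for s :: state
  have step: "\<phi> (act k s l) - \<phi> s = (if snd l then 1 else - 1)" if "valid k s" for s l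
  proof -
    obtain c b where l: "l = (c, b)" by force
    show ?thesis using that
    proof (cases rule: valid_cases)
      case (1 m)
      then show ?thesis using k3 by (cases b) (auto simp: l \<phi>_def algebra_simps of_nat_diff)
    next
      case (2 i L e m)
      then have "Suc i < k \<or> k = Suc i" by auto
      with 2 show ?thesis using k3
        by (cases b) (auto simp: l \<phi>_def canon_def algebra_simps of_nat_diff)
    qed
  qed
  define f where "f u = \<phi> (run k start u)" for u
  have diff: "f (u @ [l]) - f u = (if snd l then 1 else - 1)" for u l
    using step[OF valid_run_start] by (simp add: f_def run_append)
  have "drift f u = 0" for u
    unfolding drift_def diff sum_letters[of _ ga] by simp
  moreover have "\<bar>f (u @ [l]) - f u\<bar> \<le> 1" for u l
    unfolding diff by simp
  ultimately show ?thesis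
    using additive_functional_slln[of f 1] by (simp add: st_def f_def \<phi>_def)
qed

text \<open>The exponent sum is negligible, so \<open>k\<close> times the exponent balances the
  total length of the factors, whose rate follows from the symmetry of \<open>q\<close> under
  \<open>i \<mapsto> k - i\<close>.\<close>

lemma Delta_exponent_lln:
  "AE \<omega> in M. (\<lambda>n. real_of_int (snd (snd (st n \<omega>))) / real n) \<longlonglongrightarrow> - ((1 - x) / 4)"
proof -
  have "freq real = (1 - x) / 2 * (real k / 2)"
    unfolding freq_def by (subst q_sum_symmetric[of real "real k"]) auto
  then have freq: "(0 - freq real) / real k = - ((1 - x) / 4)" using k3 by simp
  show ?thesis
    using additive_lln[of real] exponent_sum_lln
  proof eventually_elim
    case (elim \<omega>)
    let ?L = "\<lambda>n. fst (st n \<omega>)" and ?m = "\<lambda>n. snd (snd (st n \<omega>))"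
    have "(\<lambda>n. ((real (sum_list (?L n)) + real k * real_of_int (?m n)) / real n
        - sum_list (map real (?L n)) / real n) / real k) \<longlonglongrightarrow> (0 - freq real) / real k"
      using k3 by (intro tendsto_divide tendsto_diff elim tendsto_const) auto
    moreover have "((real (sum_list (?L n)) + real k * real_of_int (?m n)) / real n
        - sum_list (map real (?L n)) / real n) / real k = real_of_int (?m n) / real n" for n
    proof -
      have "sum_list (map real (?L n)) = real (sum_list (?L n))"
        by (simp add: sum_list_of_nat)
      then show ?thesis using k3 by (simp add: add_divide_distrib)
    qed
    ultimately show ?case unfolding freq by simp
  qed
qed

end

section \<open>The random walk on the dihedral Artin group\<close>

context dihedral_artin
begin

lemma inj_cls_letter: "inj (\<lambda>l. cls [l])"
proof (rule injI)
  fix l l' assume "cls [l] = cls [l']"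
  then have "run k start [l] = run k start [l']" by (rule iffD2[OF run_start_eq_iff])
  then show "l = l'"
    by (cases l; cases l'; cases "snd l"; cases "snd l'") auto
qed

text \<open>Arbitrary off the generators, which is a null event under the step distribution by
  \<open>AE_letters\<close>.\<close>

definition letter :: "gen gword set \<Rightarrow> gen \<times> bool" where
  "letter = inv_into UNIV (\<lambda>l. cls [l])"

lemma letter_cls [simp]: "letter (cls [l]) = l"
  unfolding letter_def using inv_f_f[OF inj_cls_letter] .

end

section \<open>Transfer to the group-valued walk and the three drifts\<close>

locale artin_walk = dihedral_artin k
  for k +
  fixes \<nu> :: "gen gword set pmf" and M :: "'w measure" and x :: "nat \<Rightarrow> 'w \<Rightarrow> gen gword set"
  assumes k3: "k \<ge> 3"
    and pmf_letter: "\<And>l. pmf \<nu> (cls [l]) = 1 / 4"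
    and iid: "iid_steps M \<nu> x"
begin

text \<open>The four generators and inverses are distinct elements by \<open>inj_cls_letter\<close>,
  so their masses 1/4 exhaust the law.\<close>

lemma measure_letters: "measure \<nu> (range (\<lambda>l. cls [l])) = 1"
proof -
  have "measure \<nu> (range (\<lambda>l. cls [l])) = (\<Sum>l\<in>UNIV. pmf \<nu> (cls [l]))"
    by (subst measure_measure_pmf_finite) (simp_all add: sum.reindex inj_cls_letter)
  then show ?thesis by (simp add: pmf_letter)
qed

lemma AE_letters: "AE C in \<nu>. C = cls [letter C]"
proof -
  have "AE C in \<nu>. C \<in> range (\<lambda>l. cls [l])"
    using measure_letters by (intro measure_pmf.AE_prob_1)
  then show ?thesis by eventually_elim auto
qed

lemma measurable_step: "i \<ge> 1 \<Longrightarrow> x i \<in> measurable M (count_space UNIV)"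
  using iid by (auto simp: iid_steps_def prob_space.indep_vars_def)

sublocale letter_walk k "x_root k" M "\<lambda>i \<omega>. letter (x i \<omega>)"
proof (intro letter_walk.intro uniform_letters.intro uniform_letters_axioms.intro)
  show "F_root k (x_root k)" using k3 by (rule F_root_x_root)
  show P: "prob_space M" using iid by (simp add: iid_steps_def)
  interpret prob_space M by (fact P)
  have ind: "indep_vars (\<lambda>_. count_space UNIV) x {1..}" using iid by (simp add: iid_steps_def)
  show "indep_vars (\<lambda>_. count_space UNIV) (\<lambda>i \<omega>. letter (x i \<omega>)) {1..}"
    by (rule indep_vars_compose2[OF ind]) simp
  fix i :: nat and l assume i: "1 \<le> i"
  have "prob ((\<lambda>\<omega>. letter (x i \<omega>)) -` {l} \<inter> space M) = prob (x i -` (letter -` {l}) \<inter> space M)"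
    by (simp add: vimage_def)
  also have "\<dots> = measure (distr M (count_space UNIV) (x i)) (letter -` {l})"
    by (rule measure_distr[symmetric]) (use measurable_step[OF i] in auto)
  also have "\<dots> = measure \<nu> (letter -` {l})" using iid i by (simp add: iid_steps_def)
  \<comment> \<open>The preimage under \<open>letter\<close> may contain elements that are not
    generators, but only as a null set.\<close>
  also have "\<dots> = measure \<nu> {cls [l]}"
    using AE_letters by (intro measure_pmf.finite_measure_eq_AE) (auto elim!: eventually_mono)
  also have "\<dots> = 1 / real CARD(gen \<times> bool)" by (simp add: measure_pmf_single pmf_letter)
  finally show "prob ((\<lambda>\<omega>. letter (x i \<omega>)) -` {l} \<inter> space M) = 1 / real CARD(gen \<times> bool)" .
qed

lemma AE_walk: "AE \<omega> in M. \<forall>n. walk (artin k) x n \<omega> = cls (hist n \<omega>)"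
proof -
  have "AE \<omega> in M. \<forall>i. i \<ge> 1 \<longrightarrow> x i \<omega> = cls [letter (x i \<omega>)]"
    unfolding AE_all_countable
  proof
    fix i :: nat
    show "AE \<omega> in M. i \<ge> 1 \<longrightarrow> x i \<omega> = cls [letter (x i \<omega>)]"
    proof (cases "i \<ge> 1")
      case True
      have "distr M (count_space UNIV) (x i) = measure_pmf \<nu>"
        using iid True by (simp add: iid_steps_def)
      then have "AE C in distr M (count_space UNIV) (x i). C = cls [letter C]"
        using AE_letters by (simp only:)
      then show ?thesis by (simp add: AE_distr_iff measurable_step[OF True])
    qed simp
  qed
  then show ?thesis
  proof (rule AE_mp, intro AE_I2 impI allI)
    fix \<omega> n assume *: "\<forall>i. i \<ge> 1 \<longrightarrow> x i \<omega> = cls [letter (x i \<omega>)]"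
    have "map (\<lambda>i. x i \<omega>) [1..<Suc n] = map cls (map (\<lambda>l. [l]) (hist n \<omega>))"
      using * by (auto simp: hist_def simp del: upt_Suc)
    then show "walk (artin k) x n \<omega> = cls (hist n \<omega>)"
      unfolding walk_def by (simp only: gprod_cls) simp
  qed
qed

lemma has_driftI:
  assumes "AE \<omega> in M. (\<lambda>n. f (cls (hist n \<omega>)) / real n) \<longlonglongrightarrow> c"
  shows "has_drift M (walk (artin k) x) f c"
  unfolding has_drift_def using assms AE_walk by eventually_elim simp

lemma T_length_drift: "has_drift M (walk (artin k) x) (\<lambda>g. real (T_length k g)) ((1 - x_root k) / 2)"
proof (rule has_driftI)
  have freq: "freq (\<lambda>_. 1) = (1 - x_root k) / 2" using q_sum by (simp add: freq_def)
  show "AE \<omega> in M. (\<lambda>n. real (T_length k (cls (hist n \<omega>))) / real n) \<longlonglongrightarrow> (1 - x_root k) / 2"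
    using additive_lln[of "\<lambda>_. 1"] unfolding freq by (simp add: T_length_cls st_def sum_list_triv)
qed

lemma Delta_exp_drift:
  "has_drift M (walk (artin k) x) (\<lambda>g. real_of_int (Delta_exp k g)) (- ((1 - x_root k) / 4))"
  by (rule has_driftI) (use Delta_exponent_lln in \<open>simp add: Delta_exp_cls st_def\<close>)

text \<open>Both bounds on the word length have the rate of \<open>fold_length\<close>: the sum of
  \<open>half\<close> grows at rate \<open>(1 - x_root k) / 4\<close>, exactly opposite to the
  exponent of \<open>\<Delta>\<close>, so the correction in the upper bound is o(n).\<close>

lemma S_length_drift:
  "has_drift M (walk (artin k) x) (\<lambda>g. real (S_length k g)) (freq (\<lambda>i. real (min i (k - i))))"
proof (rule has_driftI)
  let ?c = "freq (\<lambda>i. real (min i (k - i)))"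
  have "(\<Sum>i=1..<k. q i * half k i) = 1 / 2"
    by (rule q_sum_symmetric) (auto simp: half_def)
  then have half: "freq (half k) = (1 - x_root k) / 4" by (simp add: freq_def)
  have fold: "sum_list (map (\<lambda>i. real (min i (k - i))) L) = real (fold_length k L)" for L
    by (induction L) (simp_all add: fold_length_def)
  show "AE \<omega> in M. (\<lambda>n. real (S_length k (cls (hist n \<omega>))) / real n) \<longlonglongrightarrow> ?c"
    using additive_lln[of "\<lambda>i. real (min i (k - i))"] additive_lln[of "half k"] Delta_exponent_lln
  proof eventually_elim
    case (elim \<omega>)
    let ?L = "\<lambda>n. fst (st n \<omega>)" and ?m = "\<lambda>n. real_of_int (snd (snd (st n \<omega>)))"
    let ?b = "\<lambda>n. ?m n + sum_list (map (half k) (?L n))"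
    have low: "(\<lambda>n. real (fold_length k (?L n)) / real n) \<longlonglongrightarrow> ?c"
      using elim(1) by (simp only: fold)
    have "(\<lambda>n. ?b n / real n) \<longlonglongrightarrow> 0"
      using tendsto_add[OF elim(3,2)] half by (simp add: add_divide_distrib)
    from tendsto_rabs_zero[OF this] have "(\<lambda>n. \<bar>?b n\<bar> / real n) \<longlonglongrightarrow> 0"
      by (simp add: abs_divide)
    then have "(\<lambda>n. real (fold_length k (?L n)) / real n + real k * (\<bar>?b n\<bar> / real n + 1 / real n))
        \<longlonglongrightarrow> ?c + real k * (0 + 0)"
      by (intro tendsto_add tendsto_mult tendsto_const low lim_const_over_n)
    then have up: "(\<lambda>n. (real (fold_length k (?L n)) + real k * (\<bar>?b n\<bar> + 1)) / real n) \<longlonglongrightarrow> ?c"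
      by (simp add: add_divide_distrib distrib_left)
    have le1: "real (fold_length k (?L n)) \<le> real (S_length k (cls (hist n \<omega>)))" for n
      using fold_length_le_S_length[of "hist n \<omega>"] by (simp add: st_def)
    have le2: "real (S_length k (cls (hist n \<omega>))) \<le> real (fold_length k (?L n)) + real k * (\<bar>?b n\<bar> + 1)" for n
      using S_length_le_fold_length[of "hist n \<omega>"] by (cases "st n \<omega>") (simp add: st_def)
    show ?case
      by (rule tendsto_sandwich[OF _ _ low up]) (use le1 le2 in \<open>auto intro!: always_eventually divide_right_mono\<close>)
  qed
qed

end

theorem proposition5p4:
  fixes k :: nat
    and \<nu> :: "gen gword set pmf"
    and M :: "'w measure"
    and x :: "nat \<Rightarrow> 'w \<Rightarrow> gen gword set"
  assumes "k \<ge> 3"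
    and "pmf \<nu> (gen_elt k ga) = 1/4"
    and "pmf \<nu> (inv\<^bsub>artin k\<^esub> gen_elt k ga) = 1/4"
    and "pmf \<nu> (gen_elt k gb) = 1/4"
    and "pmf \<nu> (inv\<^bsub>artin k\<^esub> gen_elt k gb) = 1/4"
    and "iid_steps M \<nu> x"
  shows "has_drift M (walk (artin k) x) (\<lambda>g. real (T_length k g)) ((1 - x_root k) / 2)
       \<and> has_drift M (walk (artin k) x) (\<lambda>g. real_of_int (Delta_exp k g)) (- ((1 - x_root k) / 4))
       \<and> (\<forall>j. k = 2 * j \<longrightarrow>
            has_drift M (walk (artin k) x) (\<lambda>g. real (S_length k g))
              ((1 - x_root k) *
                ((\<Sum>i\<in>{1..j-1}. real i * poly (F_poly i) (x_root k))
                  + real j / 2 * poly (F_poly j) (x_root k))))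
       \<and> (\<forall>j. k = 2 * j + 1 \<longrightarrow>
            has_drift M (walk (artin k) x) (\<lambda>g. real (S_length k g))
              ((1 - x_root k) * (\<Sum>i\<in>{1..j}. real i * poly (F_poly i) (x_root k))))"
proof -
  interpret dihedral_artin k using assms(1) by unfold_locales simp
  interpret artin_walk k \<nu> M x
  proof
    fix l :: "gen \<times> bool"
    obtain c b where l: "l = (c, b)" by force
    show "pmf \<nu> (cls [l]) = 1 / 4"
    proof (cases b)
      case True
      then show ?thesis using assms(2,4) by (cases c) (simp_all add: l gen_elt_def)
    next
      case False
      then show ?thesis using assms(3,5) by (cases c) (simp_all add: l inv_gen_elt)
    qed
  qed (use assms in auto)
  show ?thesis
  proof (intro conjI allI impI T_length_drift Delta_exp_drift)
    have double: "a / 2 * (2 * b) = a * b" for a b :: real by simp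
    fix j assume "k = 2 * j"
    from S_length_drift[unfolded freq_def q_sum_min_even[OF this] double]
    show "has_drift M (walk (artin k) x) (\<lambda>g. real (S_length k g))
        ((1 - x_root k) * ((\<Sum>i\<in>{1..j-1}. real i * poly (F_poly i) (x_root k))
          + real j / 2 * poly (F_poly j) (x_root k)))" .
  next
    have double: "a / 2 * (2 * b) = a * b" for a b :: real by simp
    fix j assume "k = 2 * j + 1"
    from S_length_drift[unfolded freq_def q_sum_min_odd[OF this] double]
    show "has_drift M (walk (artin k) x) (\<lambda>g. real (S_length k g))
        ((1 - x_root k) * (\<Sum>i\<in>{1..j}. real i * poly (F_poly i) (x_root k)))" .
  qed
qed

end
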